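(* Let $\alpha\in(0,1)$ and let $\tilde x$, $x^f$, $x$, $g_\alpha$, $\xi$ be as in the context, i.e. $\tilde x_{\alpha T}(T)\simeq g_\alpha T$ and $x^f_{\alpha T}(T)\simeq\xi T$. Suppose $\xi<g_\alpha$. Then for every $S\in\mathbb{R}$, $$\lim_{T\to\infty}\mathbb{P}\bigl(x^f_{\alpha T}(T)>\xi T-ST^{1/3}\bigr)=\lim_{T\to\infty}\mathbb{P}\bigl(x_{\alpha T}(t)>\xi T-f(T-t)-ST^{1/3}\ \ \forall t\in[0,T]\bigr).$$
   Context: TASEP (continuous time, on $\mathbb{Z}$): each site holds at most one particle; each particle attempts to jump one step to the right at the events of independent rate-one Poisson clocks; a jump succeeds only if the target site is empty. Particles are labelled from right to left, and $x_n(t)$ is the position of the particle with label $n$ at time $t$. $\mathbb{N}=\{1,2,\dots\}$. Wall: $f:\mathbb{R}_{\ge0}\to\mathbb{R}_{\ge0}$ is non-decreasing and càdlàg with $f(0)=0$; $f$ may depend on the observation time $T$. In a TASEP with wall $f$, a jump at time $t$ to a site strictly larger than $f(t)$ is additionally suppressed, so $x^f_1(t)\le f(t)$. Initial condition: a deterministic strictly decreasing integer sequence $\{x^f_n,n\in\mathbb{N}\}$ with $x^f_1\le 0$ and $x^f_n\ge -d_0n-C_0$ for all $n$, for some constants $d_0\ge1$, $C_0$. Processes: $(x^f(t))$ is the TASEP with wall $f$ and $x^f_n(0)=x^f_n$; $(\tilde x(t))$ is the TASEP with $\tilde x_n(0)=x^f_n$ without wall; $(x(t))$ is the TASEP with step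 initial condition $x_n(0)=-(n-1)$, $n\in\mathbb{N}$, without wall. Notation: $Y_T\simeq aT$ means that $Y_T/T\to a$ in probability as $T\to\infty$ (macroscopic scaling). Non-integer labels such as $\alpha T$ are understood with integer parts. The equality of limits means that if one of the limits exists then so does the other and they agree.
   Formalization: For real-valued walls the claim can fail by one lattice site at a jump of the limit; proved instead: for every S with f(T-t) replaced by its integer part, and with f itself for all S in any open set on which the limit is a continuous function of S. *)

theory Defs
  imports "HOL-Probability.Probability"
begin

definition cadlag :: "(real \<Rightarrow> 'a::t2_space) \<Rightarrow> bool" where
  "cadlag g \<longleftrightarrow>
     (\<forall>t\<ge>0. continuous (at_right t) g) \<and> (\<forall>t>0. \<exists>l. (g \<longlongrightarrow> l) (at_left t))"

text \<open>The value just before time \<open>t\<close>; meaningful for cadlag \<open>g\<close> and \<open>t > 0\<close>.\<close>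

definition left_limit :: "(real \<Rightarrow> 'a::t2_space) \<Rightarrow> real \<Rightarrow> 'a" where
  "left_limit g t = Lim (at_left t) g"

text \<open>A rate-one Poisson process on \<open>[0,\<infinity>)\<close>, given by its counting function. The path
  properties are required for every outcome, not just almost surely.\<close>

definition poisson_process :: "'w measure \<Rightarrow> (real \<Rightarrow> 'w \<Rightarrow> nat) \<Rightarrow> bool" where
  "poisson_process M N \<longleftrightarrow>
     (\<forall>t\<ge>0. N t \<in> measurable M (count_space UNIV)) \<and>
     (\<forall>\<omega>\<in>space M. N 0 \<omega> = 0 \<and> mono_on {0..} (\<lambda>t. N t \<omega>) \<and> cadlag (\<lambda>t. N t \<omega>)) \<and>
     (\<forall>s t. 0 \<le> s \<and> s < t \<longrightarrow>
        distr M (count_space UNIV) (\<lambda>\<omega>. N t \<omega> - N s \<omega>) = measure_pmf (poisson_pmf (t - s))) \<and>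
     (\<forall>(u :: nat \<Rightarrow> real) k. 0 \<le> u 0 \<and> mono u \<longrightarrow>
        prob_space.indep_vars M (\<lambda>_. count_space UNIV)
          (\<lambda>i \<omega>. N (u (Suc i)) \<omega> - N (u i) \<omega>) {..<k})"

definition independent_poisson_clocks :: "'w measure \<Rightarrow> (nat \<Rightarrow> real \<Rightarrow> 'w \<Rightarrow> nat) \<Rightarrow> bool" where
  "independent_poisson_clocks M N \<longleftrightarrow>
     (\<forall>n\<ge>1. poisson_process M (N n)) \<and>
     prob_space.indep_vars M (\<lambda>_. Pi\<^sub>M {0..} (\<lambda>_. count_space UNIV))
       (\<lambda>n \<omega>. \<lambda>t\<in>{0..}. N n t \<omega>) {1..}"

text \<open>\<open>tasep_path A N x0 x\<close>: the particle positions \<open>x n t\<close> (labels \<open>n \<ge> 1\<close>, label \<open>0\<close> unused)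
  follow the exclusion dynamics started from \<open>x0\<close> and driven by the clocks \<open>N n\<close>; jumps to a
  site \<open>z\<close> at time \<open>t\<close> with \<open>\<not> A t z\<close> are suppressed.\<close>

definition tasep_path ::
  "(real \<Rightarrow> int \<Rightarrow> bool) \<Rightarrow> (nat \<Rightarrow> real \<Rightarrow> nat) \<Rightarrow> (nat \<Rightarrow> int) \<Rightarrow> (nat \<Rightarrow> real \<Rightarrow> int) \<Rightarrow> bool" where
  "tasep_path A N x0 x \<longleftrightarrow>
     (\<forall>n\<ge>1. x n 0 = x0 n \<and> cadlag (x n) \<and>
       (\<forall>t>0. let y = left_limit (x n) t in
          x n t = (if N n t \<noteq> left_limit (N n) t
                      \<and> (\<forall>m\<ge>1. left_limit (x m) t \<noteq> y + 1)
                      \<and> A t (y + 1)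
                   then y + 1 else y)))"

definition tasep_with ::
  "(real \<Rightarrow> int \<Rightarrow> bool) \<Rightarrow> 'w measure \<Rightarrow> (nat \<Rightarrow> int) \<Rightarrow> (nat \<Rightarrow> real \<Rightarrow> 'w \<Rightarrow> int) \<Rightarrow> bool" where
  "tasep_with A M x0 X \<longleftrightarrow>
     (\<forall>n\<ge>1. \<forall>t\<ge>0. X n t \<in> measurable M (count_space UNIV)) \<and>
     (\<exists>N. independent_poisson_clocks M N \<and>
        (\<forall>\<omega>\<in>space M. tasep_path A (\<lambda>n t. N n t \<omega>) x0 (\<lambda>n t. X n t \<omega>)))"

definition tasep :: "'w measure \<Rightarrow> (nat \<Rightarrow> int) \<Rightarrow> (nat \<Rightarrow> real \<Rightarrow> 'w \<Rightarrow> int) \<Rightarrow> bool" where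
  "tasep = tasep_with (\<lambda>_ _. True)"

definition tasep_wall ::
  "(real \<Rightarrow> real) \<Rightarrow> 'w measure \<Rightarrow> (nat \<Rightarrow> int) \<Rightarrow> (nat \<Rightarrow> real \<Rightarrow> 'w \<Rightarrow> int) \<Rightarrow> bool" where
  "tasep_wall f = tasep_with (\<lambda>t z. real_of_int z \<le> f t)"

definition wall :: "(real \<Rightarrow> real) \<Rightarrow> bool" where
  "wall f \<longleftrightarrow> (\<forall>t\<ge>0. 0 \<le> f t) \<and> mono_on {0..} f \<and> cadlag f \<and> f 0 = 0"

definition step_initial :: "nat \<Rightarrow> int" where
  "step_initial n = - (int n - 1)"

text \<open>Convergence in probability of \<open>Y T / T\<close> to the constant \<open>a\<close> as \<open>T \<rightarrow> \<infinity>\<close>.\<close>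

definition macroscopic_limit :: "'w measure \<Rightarrow> (real \<Rightarrow> 'w \<Rightarrow> real) \<Rightarrow> real \<Rightarrow> bool" where
  "macroscopic_limit M Y a \<longleftrightarrow>
     (\<forall>\<epsilon>>0. ((\<lambda>T. measure M {\<omega> \<in> space M. \<bar>Y T \<omega> / T - a\<bar> > \<epsilon>}) \<longlongrightarrow> 0) at_top)"

text \<open>A non-integer label \<open>r\<close> stands for its integer part.\<close>

definition label :: "real \<Rightarrow> nat" where
  "label r = nat \<lfloor>r\<rfloor>"

text \<open>\<open>P(Y > c - h(T - t) - S T^(1/3) for all t in [0,T])\<close>, where \<open>h\<close> is the wall as it enters
  the comparison: the position of a wall \<open>f\<close> on the lattice is \<open>\<lfloor>f\<rfloor>\<close>.  The walls \<open>f\<close> and \<open>\<lfloor>f\<rfloor>\<close>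
  suppress exactly the same jumps, but \<open>Y > s - f\<close> and \<open>Y > s - \<lfloor>f\<rfloor>\<close> may differ by one site.\<close>

definition prob_above_wall ::
  "'w measure \<Rightarrow> (real \<Rightarrow> 'w \<Rightarrow> int) \<Rightarrow> (real \<Rightarrow> real) \<Rightarrow> real \<Rightarrow> real \<Rightarrow> real \<Rightarrow> real" where
  "prob_above_wall M Y h \<xi> S T =
     measure M {\<omega> \<in> space M. \<forall>t\<in>{0..T}.
       real_of_int (Y t \<omega>) > \<xi> * T - h (T - t) - S * T powr (1/3)}"

end

theory Submission
  imports Defs
begin

text \<open>
  TASEP with a parallel update is linear over the semiring (min, +): when clock \<open>n\<close> rings,
  \<open>x\<^sub>n\<close> becomes \<open>min (x\<^sub>n + 1) (x\<^sub>n\<^sub>-\<^sub>1 - 1)\<close>, with the wall in the role of \<open>x\<^sub>0 - 1\<close>. Hence, for processes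
  sharing the clocks of each label, the process with wall is the minimum of the process without wall
  and the process with wall started from the step initial condition, and the latter equals
  \<open>min\<^sub>u (f(u) + X\<^sub>n(u,T))\<close>, where \<open>X(u,T)\<close> is the step process without wall driven by the clock rings
  in \<open>(u,T]\<close>. Transposing the (min, +) matrices shows that \<open>X\<^sub>n(u,T)\<close> is unchanged if time is reversed
  and the labels are reflected by \<open>i \<mapsto> n + 1 - i\<close>, an operation that preserves the law of the clocks.
  Therefore \<open>P(x\<^sup>f\<^sub>n(T) > s)\<close> differs from \<open>P(x\<^sub>n(t) > s - \<lfloor>f(T - t)\<rfloor> for all t \<le> T)\<close> by at most the
  probability that the process without wall is at most \<open>s\<close>, and this vanishes because \<open>\<xi> < g\<^sub>\<alpha>\<close>.
  On a fine enough mesh every single path is an exact finite recursion, so only the joint law of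
  finitely many Bernoulli variables enters.
\<close>

section \<open>TASEP in discrete time with parallel update\<close>

text \<open>\<open>(n, l) \<in> R\<close> means that clock \<open>n\<close> rings in time step \<open>l\<close>. Several clocks may ring in the same step;
  all identities below survive this, so simultaneous rings need not be excluded.\<close>

primrec grid ::
  "(nat \<Rightarrow> int \<Rightarrow> bool) \<Rightarrow> (nat \<times> nat) set \<Rightarrow> (nat \<Rightarrow> int) \<Rightarrow> nat \<Rightarrow> nat \<Rightarrow> int" where
  "grid A R v 0 = v"
| "grid A R v (Suc l) = (\<lambda>n. let u = grid A R v l in
     if (n, l) \<in> R \<and> (n = 1 \<or> u n + 1 \<noteq> u (n - 1)) \<and> A l (u n + 1) then u n + 1 else u n)"

abbreviation free_grid :: "(nat \<times> nat) set \<Rightarrow> (nat \<Rightarrow> int) \<Rightarrow> nat \<Rightarrow> nat \<Rightarrow> int" where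
  "free_grid \<equiv> grid (\<lambda>_ _. True)"

abbreviation wall_grid ::
  "(nat \<Rightarrow> int) \<Rightarrow> (nat \<times> nat) set \<Rightarrow> (nat \<Rightarrow> int) \<Rightarrow> nat \<Rightarrow> nat \<Rightarrow> int" where
  "wall_grid w \<equiv> grid (\<lambda>l z. z \<le> w (Suc l))"

section \<open>Order preservation and the (min, +) form of the update\<close>

definition ordered :: "(nat \<Rightarrow> int) \<Rightarrow> bool" where
  "ordered v \<longleftrightarrow> (\<forall>n\<ge>1. v (Suc n) < v n)"

lemma ordered_diff:
  assumes "ordered v" "1 \<le> m" "m \<le> n"
  shows "v n + int (n - m) \<le> v m"
  using assms(3)
proof (induction n rule: dec_induct)
  case (step k)
  moreover have "v (Suc k) < v k"
    using assms step.hyps by (auto simp: ordered_def)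
  ultimately show ?case by (simp add: Suc_diff_le)
qed simp

lemma ordered_less:
  assumes "ordered v" "1 \<le> m" "m < n"
  shows "v n < v m"
  using ordered_diff[OF assms(1,2), of n] assms(3) by simp

lemma ordered_step_initial: "ordered step_initial"
  by (simp add: ordered_def step_initial_def)

text \<open>The exclusion test reads the configuration before the step, so a particle moves only if
  its gap to the next one is at least two. The particle ahead never moves left, so the order
  survives simultaneous jumps.\<close>

lemma ordered_grid:
  assumes "ordered v"
  shows "ordered (grid A R v l)"
proof (induction l)
  case (Suc l)
  show ?case
    unfolding ordered_def
  proof (intro allI impI)
    fix n :: nat assume "n \<ge> 1"
    then have "grid A R v l (Suc n) < grid A R v l n"
      using Suc by (simp add: ordered_def)
    then show "grid A R v (Suc l) (Suc n) < grid A R v (Suc l) n"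
      using \<open>n \<ge> 1\<close> by (auto simp: Let_def)
  qed
qed (use assms in simp)

text \<open>By strict order, \<open>x (n - 1) - 1\<close> is at least \<open>x n\<close>, with
  equality exactly when particle \<open>n\<close> is blocked. Hence exclusion is a minimum.\<close>

lemma free_grid_Suc:
  assumes "ordered v" "n \<ge> 1"
  shows "free_grid R v (Suc l) n =
    (if (n, l) \<in> R
     then if n = 1 then free_grid R v l 1 + 1
          else min (free_grid R v l n + 1) (free_grid R v l (n - 1) - 1)
     else free_grid R v l n)"
proof (cases "n = 1")
  case False
  then have "free_grid R v l n < free_grid R v l (n - 1)"
    using assms ordered_grid[OF assms(1)] by (intro ordered_less) auto
  then show ?thesis using False by (auto simp: Let_def)
qed (simp add: Let_def)

text \<open>The wall stops the first particle, and particle \<open>n\<close> stays at least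
  \<open>n - 1\<close> sites behind it. So for \<open>n > 1\<close> the wall forbids no jump at all,
  and only label 1 needs a wall term.\<close>

lemma wall_grid_le:
  assumes "ordered v" "v 1 \<le> w 0" "mono w" "n \<ge> 1"
  shows "wall_grid w R v l n \<le> w l + 1 - int n"
proof -
  have "wall_grid w R v l 1 \<le> w l"
  proof (induction l)
    case (Suc l)
    then show ?case using monoD[OF assms(3), of l "Suc l"] by (simp add: Let_def)
  qed (use assms in simp)
  moreover have "wall_grid w R v l n + int (n - 1) \<le> wall_grid w R v l 1"
    using assms by (intro ordered_diff ordered_grid) auto
  ultimately show ?thesis using assms by (simp add: of_nat_diff)
qed

text \<open>The wall may enter as a minimum because it never retreats: the first particle is at most
  \<open>w l\<close>, hence at most \<open>w (Suc l)\<close>, so the minimum never pushes it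
  back.\<close>

lemma wall_grid_Suc:
  assumes "ordered v" "v 1 \<le> w 0" "mono w" "n \<ge> 1"
  shows "wall_grid w R v (Suc l) n =
    (if (n, l) \<in> R
     then min (wall_grid w R v l n + 1) (if n = 1 then w (Suc l) else wall_grid w R v l (n - 1) - 1)
     else wall_grid w R v l n)"
proof -
  have w: "w l \<le> w (Suc l)" using assms(3) by (simp add: monoD)
  have le: "wall_grid w R v l n \<le> w l + 1 - int n"
    using wall_grid_le[OF assms(1-3), of n] assms(4) by simp
  show ?thesis
  proof (cases "n = 1")
    case True
    then show ?thesis using le w by (auto simp: Let_def)
  next
    case False
    then have "wall_grid w R v l n < wall_grid w R v l (n - 1)"
      using assms ordered_grid[OF assms(1)] by (intro ordered_less) auto
    then show ?thesis using False le w assms(4) by (auto simp: Let_def)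
  qed
qed

section \<open>Superposition: separating the initial condition from the wall\<close>

lemma min_jump_distrib: "min (min a b + 1) (min c d - 1) = min (min (a + 1) (c - 1)) (min (b + 1) (d - 1))"
  for a b c d :: int
  by (smt (verit))

lemma less_min_add: "s < min a b + c \<longleftrightarrow> s < a + c \<and> s < b + c"
  for a b c s :: int
  by linarith

lemma less_add_min: "s < c + min a b \<longleftrightarrow> s < c + a \<and> s < c + b"
  for a b c s :: int
  by linarith

text \<open>The update is linear over (min, +), by \<open>min_jump_distrib\<close>, so a minimum of
  two solutions persists. For label 1 the wall cap enters as an additive source, which only one of
  the two solutions has to carry.\<close>

lemma wall_grid_eq_min:
  assumes "ordered v" "v 1 \<le> 0" "mono w" "0 \<le> w 0" "n \<ge> 1"
  shows "wall_grid w R v l n = min (free_grid R v l n) (wall_grid w R step_initial l n)"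
  using assms(5)
proof (induction l arbitrary: n)
  case 0
  \<comment> \<open>Initially \<open>v\<close> lies below the step configuration, so the minimum is
    \<open>v\<close>.\<close>
  then have "v n + int (n - 1) \<le> v 1" using assms by (intro ordered_diff) auto
  then show ?case using assms(2) 0 by (simp add: step_initial_def)
next
  case (Suc l)
  have *: "n = 1 \<or> n - 1 \<ge> 1" using Suc.prems by auto
  have W: "wall_grid w R step_initial (Suc l) n =
    (if (n, l) \<in> R then min (wall_grid w R step_initial l n + 1)
       (if n = 1 then w (Suc l) else wall_grid w R step_initial l (n - 1) - 1)
     else wall_grid w R step_initial l n)"
    using assms Suc.prems by (intro wall_grid_Suc ordered_step_initial) (auto simp: step_initial_def)
  have V: "wall_grid w R v (Suc l) n =
    (if (n, l) \<in> R then min (wall_grid w R v l n + 1)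
       (if n = 1 then w (Suc l) else wall_grid w R v l (n - 1) - 1)
     else wall_grid w R v l n)"
    using assms Suc.prems by (intro wall_grid_Suc) auto
  show ?case
    using Suc.IH[OF Suc.prems] Suc.IH[of "n - 1"] *
    unfolding W V free_grid_Suc[OF assms(1) Suc.prems]
    by (auto simp: min_jump_distrib simp del: grid.simps)
qed

definition shift :: "nat \<Rightarrow> (nat \<times> nat) set \<Rightarrow> (nat \<times> nat) set" where
  "shift u R = {(i, l). (i, u + l) \<in> R}"

text \<open>Min-formulas are stated through their strict upper level sets, which avoids \<open>Min\<close> over index sets.\<close>

lemma wall_grid_greater_iff:
  assumes "mono w" "w 0 = 0" "n \<ge> 1"
  shows "s < wall_grid w R step_initial l n \<longleftrightarrow>
    (\<forall>u\<le>l. s < w u + free_grid (shift u R) step_initial (l - u) n)"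
  using assms(3)
proof (induction l arbitrary: n s)
  case 0
  then show ?case using assms by simp
next
  case (Suc l)
  let ?W = "wall_grid w R step_initial" and ?X = "\<lambda>u. free_grid (shift u R) step_initial"
  have X: "?X u (Suc l - u) n =
    (if (n, l) \<in> R
     then if n = 1 then ?X u (l - u) 1 + 1 else min (?X u (l - u) n + 1) (?X u (l - u) (n - 1) - 1)
     else ?X u (l - u) n)" if "u \<le> l" for u
    using that Suc.prems free_grid_Suc[OF ordered_step_initial, of n "shift u R" "l - u"]
    by (simp add: Suc_diff_le shift_def del: grid.simps)
  have W: "?W (Suc l) n =
    (if (n, l) \<in> R then min (?W l n + 1) (if n = 1 then w (Suc l) else ?W l (n - 1) - 1) else ?W l n)"
    using assms Suc.prems by (intro wall_grid_Suc ordered_step_initial) (auto simp: step_initial_def)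
  have w: "w l \<le> w (Suc l)" using assms(1) by (simp add: monoD)
  have le: "?W l m \<le> w l + 1 - int m" if "m \<ge> 1" for m
    using assms that by (intro wall_grid_le ordered_step_initial) (auto simp: step_initial_def)
  have IH: "s < ?W l m \<longleftrightarrow> (\<forall>u\<le>l. s < w u + ?X u (l - u) m)" if "m \<ge> 1" for m s
    using Suc.IH[OF that] .
  \<comment> \<open>The term \<open>u = Suc l\<close> is new. If the first clock rings and
    \<open>n = 1\<close>, it is the wall cap; in the other two cases it follows from the remaining
    terms by \<open>le\<close>.\<close>
  have split: "(\<forall>u\<le>Suc l. s < w u + ?X u (Suc l - u) n) \<longleftrightarrow>
      (\<forall>u\<le>l. s < w u + ?X u (Suc l - u) n) \<and> s < w (Suc l) + 1 - int n"
    by (auto simp: le_Suc_eq step_initial_def)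
  consider "(n, l) \<notin> R" | "(n, l) \<in> R" "n = 1" | "(n, l) \<in> R" "n > 1"
    using Suc.prems by linarith
  then show ?case
  proof cases
    case 1
    have "(\<forall>u\<le>l. s < w u + ?X u (Suc l - u) n) \<longleftrightarrow> s < ?W l n"
      using X 1 IH[OF Suc.prems] by (auto simp del: grid.simps)
    then show ?thesis using W 1 split le[OF Suc.prems] w by (auto simp del: grid.simps)
  next
    case 2
    have "(\<forall>u\<le>l. s < w u + ?X u (Suc l - u) n) \<longleftrightarrow> s - 1 < ?W l n"
      unfolding IH[OF Suc.prems] using X 2 by (auto simp del: grid.simps)
    then show ?thesis using W 2 split by (auto simp del: grid.simps)
  next
    case 3
    have "(\<forall>u\<le>l. s < w u + ?X u (Suc l - u) n) \<longleftrightarrow> s - 1 < ?W l n \<and> s + 1 < ?W l (n - 1)"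
    proof -
      have "s < w u + ?X u (Suc l - u) n \<longleftrightarrow>
          s - 1 < w u + ?X u (l - u) n \<and> s + 1 < w u + ?X u (l - u) (n - 1)" if "u \<le> l" for u
        unfolding X[OF that] using 3 by (simp, linarith)
      then show ?thesis
        using IH[OF Suc.prems, of "s - 1"] IH[of "n - 1" "s + 1"] 3(2) by auto
    qed
    moreover have "s < w (Suc l) + 1 - int n" if "s + 1 < ?W l (n - 1)"
    proof -
      have "int (n - 1) = int n - 1" "1 \<le> n - 1" using 3 by auto
      then show ?thesis using le[of "n - 1"] w that by linarith
    qed
    moreover have "s < ?W (Suc l) n \<longleftrightarrow> s - 1 < ?W l n \<and> s + 1 < ?W l (n - 1)"
      unfolding W using 3 by (simp, linarith)
    ultimately show ?thesis unfolding split by blast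
  qed
qed

section \<open>Duality and time reversal\<close>

text \<open>The (min, +) row vector \<open>e\<^sub>n\<^sup>T\<close> multiplied from the right by the transition matrices, latest step first,
  read in the reflected labels. Its initial value is \<open>step_initial\<close> rather than the unit vector
  (with entries \<open>\<infinity>\<close>); the two agree as functionals on ordered configurations.\<close>

primrec dual_grid :: "(nat \<times> nat) set \<Rightarrow> nat \<Rightarrow> nat \<Rightarrow> int" where
  "dual_grid R 0 = step_initial"
| "dual_grid R (Suc l) = (\<lambda>n. let z = dual_grid R l in
     min (if (n, l) \<in> R then z n + 1 else z n)
         (if n > 1 \<and> (n - 1, l) \<in> R then z (n - 1) - 1 else z n + 1))"

text \<open>Induction step of \<open>free_grid_dual\<close> for label 2: \<open>p\<close> and
  \<open>q\<close> are the rings of labels 2 and 1, and \<open>a\<close>, \<open>b\<close> the dual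
  entries. The default \<open>a + 1\<close> stands for an infinite matrix entry, since it never
  falls below the first argument of the minimum.\<close>

lemma dual_jump_second:
  "(if p then min (min a (b - 1) + 1) (b - 1) else min a (b - 1)) =
   min (min (if p then a + 1 else a) (if q then b - 1 else a + 1)) ((if q then b + 1 else b) - 1)"
  for a b :: int
  by (smt (verit))

text \<open>The same step for \<open>n > 2\<close>, with \<open>c\<close> the position of particle
  \<open>n - 2\<close>.\<close>

lemma dual_jump:
  "(if p then min (min a (min b (c - 1) - 1) + 1) (min b (c - 1) - 1) else min a (min b (c - 1) - 1)) =
   min (min (if p then a + 1 else a) (if q then b - 1 else a + 1))
     ((if q then min (min b (c - 1) + 1) (c - 1) else min b (c - 1)) - 1)"
  for a b c :: int
  by (smt (verit))

text \<open>The dual vector need not be ordered; the process from the step configuration is the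
  largest ordered configuration below it. Both evolve under the same rings in the same order, so
  induction over time suffices.\<close>

lemma free_grid_dual:
  assumes "n \<ge> 1"
  shows "free_grid R step_initial l n =
    (if n = 1 then dual_grid R l 1
     else min (dual_grid R l n) (free_grid R step_initial l (n - 1) - 1))"
  using assms
proof (induction l arbitrary: n)
  case 0
  then show ?case by (auto simp: step_initial_def)
next
  case (Suc l)
  note S = free_grid_Suc[OF ordered_step_initial]
  consider "n = 1" | "n = 2" | "n > 2" using Suc.prems by linarith
  then show ?case
  proof cases
    case 1
    then show ?thesis using Suc.IH[of 1] by (simp add: S Let_def del: grid.simps)
  next
    case 2
    have F: "free_grid R step_initial l 1 = dual_grid R l 1"
      "free_grid R step_initial l 2 = min (dual_grid R l 2) (dual_grid R l 1 - 1)"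
      using Suc.IH[of 1] Suc.IH[of 2] by (auto simp del: grid.simps)
    have F': "free_grid R step_initial (Suc l) 2 =
      (if (2, l) \<in> R then min (free_grid R step_initial l 2 + 1) (free_grid R step_initial l 1 - 1)
       else free_grid R step_initial l 2)"
      "free_grid R step_initial (Suc l) 1 =
      (if (1, l) \<in> R then free_grid R step_initial l 1 + 1 else free_grid R step_initial l 1)"
      using S[of 2 R l] S[of 1 R l] by (auto simp del: grid.simps)
    have z: "dual_grid R (Suc l) 2 = min (if (2, l) \<in> R then dual_grid R l 2 + 1 else dual_grid R l 2)
       (if (1, l) \<in> R then dual_grid R l 1 - 1 else dual_grid R l 2 + 1)"
      by (simp add: Let_def)
    have n: "((2::nat) = 1) = False" "(2::nat) - 1 = 1" by simp_all
    show ?thesis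
      unfolding 2 n if_False F' z F by (rule dual_jump_second)
  next
    case 3
    then have "n - 1 - 1 = n - 2" "n - 1 \<noteq> 1" by auto
    then have F: "free_grid R step_initial l (n - 1) =
        min (dual_grid R l (n - 1)) (free_grid R step_initial l (n - 2) - 1)"
      "free_grid R step_initial l n = min (dual_grid R l n)
        (min (dual_grid R l (n - 1)) (free_grid R step_initial l (n - 2) - 1) - 1)"
    proof -
      have "1 \<le> n - 1" "1 \<le> n" "n \<noteq> 1" using 3 by auto
      then show "free_grid R step_initial l (n - 1) =
          min (dual_grid R l (n - 1)) (free_grid R step_initial l (n - 2) - 1)"
        using Suc.IH[of "n - 1"] \<open>n - 1 - 1 = n - 2\<close> \<open>n - 1 \<noteq> 1\<close> by (simp only: if_False)
      with Suc.IH[of n] \<open>1 \<le> n\<close> \<open>n \<noteq> 1\<close> show "free_grid R step_initial l n = min (dual_grid R l n)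
          (min (dual_grid R l (n - 1)) (free_grid R step_initial l (n - 2) - 1) - 1)"
        by (simp only: if_False)
    qed
    have F': "free_grid R step_initial (Suc l) n =
      (if (n, l) \<in> R then min (free_grid R step_initial l n + 1) (free_grid R step_initial l (n - 1) - 1)
       else free_grid R step_initial l n)"
      "free_grid R step_initial (Suc l) (n - 1) =
      (if (n - 1, l) \<in> R then min (free_grid R step_initial l (n - 1) + 1) (free_grid R step_initial l (n - 2) - 1)
       else free_grid R step_initial l (n - 1))"
      using 3 S[of n R l] S[of "n - 1" R l] \<open>n - 1 - 1 = n - 2\<close> by (auto simp del: grid.simps)
    have z: "dual_grid R (Suc l) n = min (if (n, l) \<in> R then dual_grid R l n + 1 else dual_grid R l n)
       (if (n - 1, l) \<in> R then dual_grid R l (n - 1) - 1 else dual_grid R l n + 1)"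
      using 3 by (simp add: Let_def)
    have n: "(n = 1) = False" using 3 by simp
    show ?thesis
      unfolding n if_False F' z F by (rule dual_jump)
  qed
qed

text \<open>Unrolls the recursion. As \<open>step_initial (n + 1 - i)\<close> is
  \<open>- (n - i)\<close>, the right side is the (min, +) pairing of the dual vector with the step
  configuration in reflected labels.\<close>

lemma free_grid_greater_iff_dual:
  assumes "n \<ge> 1"
  shows "s < free_grid R step_initial l n \<longleftrightarrow> (\<forall>i\<in>{1..n}. s < dual_grid R l i - int (n - i))"
  using assms
proof (induction n arbitrary: s rule: dec_induct)
  case base
  show ?case using free_grid_dual[of 1 R l] by (simp del: grid.simps)
next
  case (step n)
  have "s < free_grid R step_initial l (Suc n) \<longleftrightarrow>
      s < dual_grid R l (Suc n) \<and> s + 1 < free_grid R step_initial l n"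
    using free_grid_dual[of "Suc n" R l] step.hyps by (auto simp del: grid.simps)
  also have "\<dots> \<longleftrightarrow> (\<forall>i\<in>{1..Suc n}. s < dual_grid R l i - int (Suc n - i))"
    unfolding step.IH using step.hyps
    by (auto simp: atLeastAtMostSuc_conv Suc_diff_le simp del: grid.simps)
  finally show ?case .
qed

text \<open>Transposition: in a product of row vector, matrices and column vector, the matrices can
  be absorbed one by one from the column into the row. Once all are absorbed, the row is paired with
  the initial step configuration, and \<open>free_grid_greater_iff_dual\<close> reads this pairing
  as a process driven by \<open>R'\<close>.\<close>

lemma free_grid_reverse:
  assumes "n \<ge> 1"
    and rev: "\<And>i l. 1 \<le> i \<Longrightarrow> i \<le> n \<Longrightarrow> l < L \<Longrightarrow> (i, l) \<in> R \<longleftrightarrow> (n + 1 - i, L - 1 - l) \<in> R'"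
  shows "free_grid R step_initial L n = free_grid R' step_initial L n"
proof -
  let ?F = "free_grid R step_initial" and ?z = "dual_grid R'"
  \<comment> \<open>Interpolates between \<open>R\<close> (\<open>k = 0\<close>) and \<open>R'\<close> (\<open>k = L\<close>): the last \<open>k\<close> steps have been moved to the dual side.\<close>
  have main: "s < ?F L n \<longleftrightarrow> (\<forall>i\<in>{1..n}. s < ?z k i + ?F (L - k) (n + 1 - i))" if "k \<le> L" for s k
    using that
  proof (induction k)
    case 0
    \<comment> \<open>By order the term \<open>i = 1\<close> attains the minimum, so pairing with
      \<open>step_initial\<close> selects particle \<open>n\<close> just as the unit vector
      would.\<close>
    have "?F L n + int (i - 1) \<le> ?F L (n + 1 - i)" if "i \<in> {1..n}" for i
      using ordered_diff[OF ordered_grid[OF ordered_step_initial], of "n + 1 - i" n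
          "\<lambda>_ _. True" R L] that
      by (auto simp: of_nat_diff simp del: grid.simps)
    then have le: "?F L n \<le> ?z 0 i + ?F L (n + 1 - i)" if "i \<in> {1..n}" for i
      using that by (fastforce simp: step_initial_def of_nat_diff)
    have eq: "?F L n = ?z 0 1 + ?F L (n + 1 - 1)" "1 \<in> {1..n}"
      using assms(1) by (auto simp: step_initial_def)
    have "s < ?F L n \<longleftrightarrow> (\<forall>i\<in>{1..n}. s < ?z 0 i + ?F L (n + 1 - i))"
    proof (intro iffI ballI)
      fix i assume "s < ?F L n" "i \<in> {1..n}"
      then show "s < ?z 0 i + ?F L (n + 1 - i)" using le[of i] by linarith
    next
      assume "\<forall>i\<in>{1..n}. s < ?z 0 i + ?F L (n + 1 - i)"
      then show "s < ?F L n" using eq by metis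
    qed
    then show ?case unfolding diff_zero .
  next
    case (Suc k)
    define l where "l = L - Suc k"
    have l: "L - k = Suc l" "l < L" "L - 1 - l = k" using Suc.prems by (auto simp: l_def)
    have ring: "(n + 1 - i, l) \<in> R \<longleftrightarrow> (i, k) \<in> R'" if "i \<in> {1..n}" for i
    proof -
      have "1 \<le> n + 1 - i" "n + 1 - i \<le> n" "n + 1 - (n + 1 - i) = i" using that by auto
      then show ?thesis using rev[of "n + 1 - i" l] l by simp
    qed
    have F: "?F (Suc l) (n + 1 - i) =
       (if (i, k) \<in> R'
        then if i = n then ?F l 1 + 1 else min (?F l (n + 1 - i) + 1) (?F l (n - i) - 1)
        else ?F l (n + 1 - i))" if "i \<in> {1..n}" for i
      using that free_grid_Suc[OF ordered_step_initial, of "n + 1 - i" R l] ring[OF that]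
      by (auto simp: Suc_diff_le simp del: grid.simps)
    \<comment> \<open>Associativity of the product: the matrix of one time step acts on the column
      on the left side and on the row on the right side.\<close>
    have "(\<forall>i\<in>{1..n}. s < ?z k i + ?F (Suc l) (n + 1 - i)) \<longleftrightarrow>
        (\<forall>i\<in>{1..n}. s < ?z (Suc k) i + ?F l (n + 1 - i))" (is "?A \<longleftrightarrow> ?B")
    proof
      assume A: ?A
      show ?B
      proof
        fix i assume i: "i \<in> {1..n}"
        have 1: "s < ?z k i + ?F (Suc l) (n + 1 - i)" using A i by blast
        have 2: "s < ?z k (i - 1) + ?F (Suc l) (n + 1 - (i - 1))" if "i > 1"
        proof -
          have "i - 1 \<in> {1..n}" using i that by auto
          then show ?thesis using A by blast
        qed
        have "n - (i - 1) = n + 1 - i" using i by auto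
        have 3: "?F (Suc l) (n + 1 - (i - 1)) \<le> ?F l (n + 1 - i) - 1"
          if "i > 1" "(i - 1, k) \<in> R'"
        proof -
          have j: "i - 1 \<in> {1..n}" "i - 1 \<noteq> n" using i that by auto
          have "?F (Suc l) (n + 1 - (i - 1)) =
              min (?F l (n + 1 - (i - 1)) + 1) (?F l (n - (i - 1)) - 1)"
            using F[OF j(1)] j(2) that by (simp only: if_True if_False)
          also have "\<dots> \<le> ?F l (n - (i - 1)) - 1" by (rule min.cobounded2)
          finally show ?thesis unfolding \<open>n - (i - 1) = n + 1 - i\<close> .
        qed
        have 4: "?F (Suc l) (n + 1 - i) \<le> ?F l (n + 1 - i) + (if (i, k) \<in> R' then 1 else 0)"
          using F[OF i] by (auto simp del: grid.simps)
        show "s < ?z (Suc k) i + ?F l (n + 1 - i)"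
          using 1 2 3 4 by (auto simp: Let_def less_min_add simp del: grid.simps)
      qed
    next
      assume B: ?B
      show ?A
      proof
        fix i assume i: "i \<in> {1..n}"
        have 1: "s < ?z (Suc k) i + ?F l (n + 1 - i)" using B i by blast
        have 2: "s < ?z (Suc k) (Suc i) + ?F l (n - i)" if "i \<noteq> n"
          using B[rule_format, of "Suc i"] i that by auto
        have "i = n \<Longrightarrow> n + 1 - i = 1" by simp
        then show "s < ?z k i + ?F (Suc l) (n + 1 - i)"
          using 1 2 F[OF i] i by (auto simp: Let_def less_min_add less_add_min simp del: grid.simps split: if_splits)

      qed
    qed
    then show ?case using Suc l by (simp add: l_def del: grid.simps)
  qed
  have "s < ?F L n \<longleftrightarrow> s < free_grid R' step_initial L n" for s
  proof -
    have "?z L i + ?F 0 (n + 1 - i) = ?z L i - int (n - i)" if "i \<in> {1..n}" for i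
      using that by (simp add: step_initial_def of_nat_diff)
    then have "(\<forall>i\<in>{1..n}. s < ?z L i + ?F (L - L) (n + 1 - i)) \<longleftrightarrow>
        (\<forall>i\<in>{1..n}. s < ?z L i - int (n - i))"
      by (intro ball_cong) (simp_all only: diff_self_eq_0)
    then show ?thesis
      using main[of L s] free_grid_greater_iff_dual[OF assms(1), of s R' L] by simp
  qed
  from this[of "?F L n"] this[of "free_grid R' step_initial L n"] show ?thesis
    by linarith
qed

text \<open>Reversal at \<open>L\<close> maps the steps from \<open>u\<close> to \<open>L\<close>
  onto the first \<open>L - u\<close> steps. So the processes restarted at the various times
  \<open>u\<close>, which are different processes, become one process driven by \<open>R'\<close>,
  observed at the times \<open>L - u\<close>.\<close>

lemma wall_grid_greater_iff_reverse:
  assumes "mono w" "w 0 = 0" "n \<ge> 1"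
    and rev: "\<And>i l. 1 \<le> i \<Longrightarrow> i \<le> n \<Longrightarrow> l < L \<Longrightarrow> (i, l) \<in> R \<longleftrightarrow> (n + 1 - i, L - 1 - l) \<in> R'"
  shows "s < wall_grid w R step_initial L n \<longleftrightarrow>
    (\<forall>k\<le>L. s - w (L - k) < free_grid R' step_initial k n)"
proof -
  have "free_grid (shift u R) step_initial (L - u) n = free_grid R' step_initial (L - u) n" if "u \<le> L" for u
    using assms(3)
  proof (rule free_grid_reverse)
    fix i l assume "1 \<le> i" "i \<le> n" "l < L - u"
    then show "(i, l) \<in> shift u R \<longleftrightarrow> (n + 1 - i, L - u - 1 - l) \<in> R'"
      using rev[of i "u + l"] by (simp add: shift_def)
  qed
  then have "s < wall_grid w R step_initial L n \<longleftrightarrow>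
      (\<forall>u\<le>L. s - w u < free_grid R' step_initial (L - u) n)"
    using assms by (subst wall_grid_greater_iff) (auto simp: algebra_simps simp del: grid.simps)
  also have "\<dots> \<longleftrightarrow> (\<forall>k\<le>L. s - w (L - k) < free_grid R' step_initial k n)"
  proof (intro iffI allI impI)
    fix k assume "\<forall>u\<le>L. s - w u < free_grid R' step_initial (L - u) n" "k \<le> L"
    then show "s - w (L - k) < free_grid R' step_initial k n" by (auto dest: spec[of _ "L - k"])
  next
    fix u assume "\<forall>k\<le>L. s - w (L - k) < free_grid R' step_initial k n" "u \<le> L"
    then show "s - w u < free_grid R' step_initial (L - u) n" by (auto dest: spec[of _ "L - u"])
  qed
  finally show ?thesis .
qed

section \<open>Paths on a fine mesh\<close>

text \<open>Cadlag paths with discrete values, stated without a topology on \<open>'a\<close>, so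
  that tuples, finite families and predicate-valued paths are covered as well.\<close>

definition step_fun :: "(real \<Rightarrow> 'a) \<Rightarrow> bool" where
  "step_fun G \<longleftrightarrow> (\<forall>t\<ge>0. \<forall>\<^sub>F s in at_right t. G s = G t) \<and>
     (\<forall>t>0. \<exists>c. \<forall>\<^sub>F s in at_left t. G s = c)"

lemma cadlag_imp_step_fun:
  fixes G :: "real \<Rightarrow> 'a::{discrete_topology, t2_space}"
  assumes "cadlag G"
  shows "step_fun G"
  using assms by (auto simp: cadlag_def step_fun_def continuous_within tendsto_discrete)

lemma step_fun_compose: "step_fun G \<Longrightarrow> step_fun (\<lambda>t. h (G t))"
  unfolding step_fun_def
proof (intro conjI allI impI)
  fix t :: real assume G: "(\<forall>t\<ge>0. \<forall>\<^sub>F s in at_right t. G s = G t) \<and> (\<forall>t>0. \<exists>c. \<forall>\<^sub>F s in at_left t. G s = c)"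
  show "\<forall>\<^sub>F s in at_right t. h (G s) = h (G t)" if "t \<ge> 0"
  proof -
    have "\<forall>\<^sub>F s in at_right t. G s = G t" using G that by simp
    then show ?thesis by eventually_elim simp
  qed
  show "\<exists>c. \<forall>\<^sub>F s in at_left t. h (G s) = c" if "t > 0"
  proof -
    obtain c where "\<forall>\<^sub>F s in at_left t. G s = c" using G \<open>t > 0\<close> by meson
    then have "\<forall>\<^sub>F s in at_left t. h (G s) = h c" by eventually_elim simp
    then show ?thesis by blast
  qed
qed

lemma step_fun_const: "step_fun (\<lambda>_. c)"
  by (auto simp: step_fun_def)

lemma step_fun_Pair:
  assumes "step_fun G" "step_fun H"
  shows "step_fun (\<lambda>t. (G t, H t))"
  unfolding step_fun_def
proof (intro conjI allI impI)
  fix t :: real assume "t \<ge> 0"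
  then have "\<forall>\<^sub>F s in at_right t. G s = G t" "\<forall>\<^sub>F s in at_right t. H s = H t"
    using assms by (auto simp: step_fun_def)
  then show "\<forall>\<^sub>F s in at_right t. (G s, H s) = (G t, H t)"
    by eventually_elim simp
next
  fix t :: real assume "t > 0"
  then obtain c d where "\<forall>\<^sub>F s in at_left t. G s = c" "\<forall>\<^sub>F s in at_left t. H s = d"
    using assms unfolding step_fun_def by meson
  then have "\<forall>\<^sub>F s in at_left t. (G s, H s) = (c, d)"
    by eventually_elim simp
  then show "\<exists>c. \<forall>\<^sub>F s in at_left t. (G s, H s) = c" by blast
qed

lemma step_fun_restrict:
  assumes "finite I" "\<And>i. i \<in> I \<Longrightarrow> step_fun (F i)"
  shows "step_fun (\<lambda>t. \<lambda>i\<in>I. F i t)"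
  unfolding step_fun_def
proof (intro conjI allI impI)
  fix t :: real assume "t \<ge> 0"
  then have "\<forall>i\<in>I. \<forall>\<^sub>F s in at_right t. F i s = F i t"
    using assms by (auto simp: step_fun_def)
  then have "\<forall>\<^sub>F s in at_right t. \<forall>i\<in>I. F i s = F i t"
    using assms(1) by (simp add: eventually_ball_finite)
  then show "\<forall>\<^sub>F s in at_right t. (\<lambda>i\<in>I. F i s) = (\<lambda>i\<in>I. F i t)"
    by eventually_elim auto
next
  fix t :: real assume "t > 0"
  then have "\<forall>i\<in>I. \<exists>c. \<forall>\<^sub>F s in at_left t. F i s = c"
    using assms by (auto simp: step_fun_def)
  then obtain c where "\<forall>i\<in>I. \<forall>\<^sub>F s in at_left t. F i s = c i"
    by metis
  then have "\<forall>\<^sub>F s in at_left t. \<forall>i\<in>I. F i s = c i"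
    using assms(1) by (simp add: eventually_ball_finite)
  then have "\<forall>\<^sub>F s in at_left t. (\<lambda>i\<in>I. F i s) = (\<lambda>i\<in>I. c i)"
    by eventually_elim auto
  then show "\<exists>c. \<forall>\<^sub>F s in at_left t. (\<lambda>i\<in>I. F i s) = c" by blast
qed

text \<open>On \<open>{0..<t}\<close> the function is bounded and takes finitely many values, so it
  attains its maximum and is constant from there on.\<close>

lemma mono_imp_ex_left_value:
  fixes G :: "real \<Rightarrow> int"
  assumes "mono_on {0..} G" "t > 0"
  shows "\<exists>c. \<forall>\<^sub>F s in at_left t. G s = c"
proof -
  have fin: "finite (G ` {0..<t})"
  proof (rule finite_subset)
    show "G ` {0..<t} \<subseteq> {G 0..G t}"
      using assms by (auto intro!: mono_onD[OF assms(1)])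
  qed simp
  have "G ` {0..<t} \<noteq> {}" using assms by auto
  then obtain s0 where s0: "s0 \<in> {0..<t}" "G s0 = Max (G ` {0..<t})"
    using Max_in[OF fin] by auto
  have "G s = G s0" if "s0 < s" "s < t" for s
    using that s0 fin mono_onD[OF assms(1), of s0 s]
    by (intro antisym) auto
  moreover have "\<forall>\<^sub>F s in at_left t. s0 < s \<and> s < t"
    using s0 eventually_at_left_real[of s0 t] by (auto elim: eventually_mono)
  ultimately have "\<forall>\<^sub>F s in at_left t. G s = G s0"
    by (auto elim: eventually_mono)
  then show ?thesis by blast
qed

text \<open>The floor of a cadlag function may oscillate, so monotonicity is essential: to the right
  the floor cannot drop, and right continuity keeps it from rising at once; to the left a monotone
  integer function settles.\<close>

lemma step_fun_floor:
  fixes g :: "real \<Rightarrow> real"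
  assumes "mono_on {0..} g" "\<And>t. t \<ge> 0 \<Longrightarrow> continuous (at_right t) g"
  shows "step_fun (\<lambda>t. \<lfloor>g t\<rfloor>)"
  unfolding step_fun_def
proof (intro conjI allI impI)
  fix t :: real assume t: "t \<ge> 0"
  have "(g \<longlongrightarrow> g t) (at_right t)"
    using assms(2)[OF t] by (simp add: continuous_within)
  then have "\<forall>\<^sub>F s in at_right t. g s < \<lfloor>g t\<rfloor> + 1"
    by (rule order_tendstoD) linarith
  moreover have "\<forall>\<^sub>F s in at_right t. t < s"
    by (simp add: eventually_at_right_less)
  ultimately show "\<forall>\<^sub>F s in at_right t. \<lfloor>g s\<rfloor> = \<lfloor>g t\<rfloor>"
  proof eventually_elim
    case (elim s)
    then have "g t \<le> g s" using t by (intro mono_onD[OF assms(1)]) auto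
    then show ?case using elim by (intro floor_unique) linarith+
  qed
next
  fix t :: real assume "t > 0"
  have "mono_on {0..} (\<lambda>t. \<lfloor>g t\<rfloor>)"
    using assms(1) by (auto simp: mono_on_def intro!: floor_mono)
  then show "\<exists>c. \<forall>\<^sub>F s in at_left t. \<lfloor>g s\<rfloor> = c"
    using \<open>t > 0\<close> by (rule mono_imp_ex_left_value)
qed

lemma step_fun_local:
  assumes "step_fun G" "t \<ge> 0"
  shows "\<exists>d>0. \<exists>c. \<forall>s\<ge>0. \<bar>s - t\<bar> < d \<longrightarrow> G s = (if s < t then c else G t)"
proof -
  obtain b where b: "b > t" "\<forall>y>t. y < b \<longrightarrow> G y = G t"
    using assms by (auto simp: step_fun_def eventually_at_right_field)
  show ?thesis
  proof (cases "t = 0")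
    case True
    then show ?thesis using b by (intro exI[of _ b]) (auto simp: less_le)
  next
    case False
    then have "t > 0" using assms(2) by simp
    then obtain c where "\<forall>\<^sub>F s in at_left t. G s = c"
      using assms(1) unfolding step_fun_def by meson
    then obtain a where a: "a < t" "\<forall>y>a. y < t \<longrightarrow> G y = c"
      by (auto simp: eventually_at_left_field)
    show ?thesis
    proof (intro exI[of _ "min (t - a) (b - t)"] conjI exI[of _ c] allI impI)
      show "0 < min (t - a) (b - t)" using a b by simp
      fix s :: real assume "\<bar>s - t\<bar> < min (t - a) (b - t)"
      then have "a < s" "s < b" by linarith+
      then show "G s = (if s < t then c else G t)"
        using a b by (cases s t rule: linorder_cases) auto
    qed
  qed
qed

abbreviation mesh :: "real \<Rightarrow> nat \<Rightarrow> nat \<Rightarrow> real" where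
  "mesh T L k \<equiv> real k * T / real L"

text \<open>Around each time there is a ball in which \<open>G\<close> changes at most at the
  centre. By the Lebesgue number lemma every cell of a fine enough mesh lies in one such
  ball.\<close>

lemma step_fun_mesh:
  assumes "step_fun G" "T > 0"
  shows "\<forall>\<^sub>F L in sequentially. \<forall>l<L. \<exists>t. mesh T L l < t \<and> t \<le> mesh T L (Suc l) \<and>
    (\<forall>s. mesh T L l \<le> s \<and> s \<le> mesh T L (Suc l) \<longrightarrow>
       G s = (if s < t then G (mesh T L l) else G (mesh T L (Suc l))))"
proof -
  let ?local = "\<lambda>t d. \<exists>c. \<forall>s\<ge>0. \<bar>s - t\<bar> < d \<longrightarrow> G s = (if s < t then c else G t)"
  define \<C> where "\<C> = {ball t d | t d. t \<in> {0..T} \<and> d > 0 \<and> ?local t d}"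
  have 1: "{0..T} \<subseteq> \<Union>\<C>"
  proof
    fix t assume t: "t \<in> {0..T}"
    then obtain d where "d > 0" "?local t d"
      using step_fun_local[OF assms(1), of t] by auto
    then have "ball t d \<in> \<C>" using t unfolding \<C>_def by blast
    moreover have "t \<in> ball t d" using \<open>d > 0\<close> by simp
    ultimately show "t \<in> \<Union>\<C>" by blast
  qed
  have 2: "\<C> \<noteq> {}" using 1 assms(2) by auto
  have 3: "\<And>B. B \<in> \<C> \<Longrightarrow> open B" by (auto simp: \<C>_def)
  obtain \<delta> where \<delta>: "\<delta> > 0" "\<And>X. X \<subseteq> {0..T} \<Longrightarrow> diameter X < \<delta> \<Longrightarrow> \<exists>B\<in>\<C>. X \<subseteq> B"
    using Lebesgue_number_lemma[OF compact_Icc 2 1 3] by blast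
  have "(\<lambda>L. T / real L) \<longlonglongrightarrow> 0"
    by (rule lim_const_over_n)
  then have "\<forall>\<^sub>F L in sequentially. T / real L < \<delta>"
    using \<delta>(1) by (rule order_tendstoD)
  then show ?thesis
    using eventually_gt_at_top[of 0]
  proof eventually_elim
    case (elim L)
    show ?case
    proof (intro allI impI)
      fix l assume l: "l < L"
      define a b where "a = mesh T L l" and "b = mesh T L (Suc l)"
      have ab: "b = a + T / real L" "0 \<le> a" "a < b"
        using assms elim by (auto simp: a_def b_def field_simps)
      have "real (Suc l) * T \<le> real L * T"
        using l assms by (intro mult_right_mono) auto
      then have bT: "b \<le> T" using elim by (simp add: b_def field_simps)
      have "{a..b} \<subseteq> {0..T}" "diameter {a..b} < \<delta>" using ab bT elim by auto
      then obtain B where "B \<in> \<C>" "{a..b} \<subseteq> B"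
        using \<delta>(2) by blast
      then obtain t d where t: "{a..b} \<subseteq> ball t d" and "?local t d"
        unfolding \<C>_def by blast
      then obtain c where c: "\<And>s. s \<ge> 0 \<Longrightarrow> \<bar>s - t\<bar> < d \<Longrightarrow> G s = (if s < t then c else G t)"
        by blast
      have G: "G s = (if s < t then c else G t)" if "a \<le> s" "s \<le> b" for s
      proof -
        have "s \<in> ball t d" using t that by auto
        then have "\<bar>s - t\<bar> < d" by (simp add: dist_real_def abs_minus_commute)
        then show ?thesis using c[of s] that ab by simp
      qed
      \<comment> \<open>If the centre \<open>t\<close> is not in the cell, or is its left end,
        \<open>G\<close> is constant on the cell, and the right end serves as the change
        time.\<close>
      define t' where "t' = (if a < t \<and> t \<le> b then t else b)"
      have "a < t'" "t' \<le> b" using ab by (auto simp: t'_def)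
      moreover have "G s = (if s < t' then G a else G b)" if "a \<le> s" "s \<le> b" for s
        using G[of s] G[of a] G[of b] that ab by (auto simp: t'_def split: if_splits)
      ultimately show "\<exists>t. mesh T L l < t \<and> t \<le> mesh T L (Suc l) \<and>
        (\<forall>s. mesh T L l \<le> s \<and> s \<le> mesh T L (Suc l) \<longrightarrow>
           G s = (if s < t then G (mesh T L l) else G (mesh T L (Suc l))))"
        unfolding a_def b_def by blast
    qed
  qed
qed

section \<open>Order of the particles and exactness of the grid recursion\<close>

lemma left_limit_eqI:
  assumes "a < t" "\<And>s. a \<le> s \<Longrightarrow> s < t \<Longrightarrow> g s = c"
  shows "left_limit g t = c"
proof -
  have "\<forall>\<^sub>F s in at_left t. g s = c"
    using assms eventually_at_left_real[of a t] by (auto elim: eventually_mono)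
  then have "(g \<longlongrightarrow> c) (at_left t)"
    by (rule tendsto_eventually)
  then show ?thesis
    unfolding left_limit_def by (intro tendsto_Lim) auto
qed

text \<open>Strictness survives the limit because integer cadlag paths are constant shortly before
  \<open>t\<close>.\<close>

lemma left_limit_less:
  fixes g h :: "real \<Rightarrow> int"
  assumes "cadlag g" "cadlag h" "t > 0" "\<And>s. s \<ge> 0 \<Longrightarrow> g s < h s"
  shows "left_limit g t < left_limit h t"
proof -
  obtain c where c: "\<forall>\<^sub>F s in at_left t. (g s, h s) = c"
    using step_fun_Pair[OF assms(1,2)[THEN cadlag_imp_step_fun]] assms(3) by (auto simp: step_fun_def)
  then obtain b where b: "b < t" "\<And>y. b < y \<Longrightarrow> y < t \<Longrightarrow> (g y, h y) = c"
    by (auto simp: eventually_at_left_field)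
  define a where "a = max 0 ((b + t) / 2)"
  have a: "b < a" "a < t" "0 \<le> a" using b assms(3) by (auto simp: a_def less_max_iff_disj)
  have "g s = fst c \<and> h s = snd c" if "a \<le> s" "s < t" for s
    using b(2)[of s] that a by (cases c) auto
  then have "left_limit g t = fst c" "left_limit h t = snd c"
    using a by (auto intro!: left_limit_eqI[of a])
  moreover have "fst c < snd c" using b(2)[of a] assms(4)[of a] a by auto
  ultimately show ?thesis by simp
qed

text \<open>The dynamics is a rule at each single time. A mesh on which the pair of neighbours
  changes at most once per cell turns it into an induction over cells.\<close>

lemma tasep_path_less:
  assumes "tasep_path A N v x" "ordered v" "n \<ge> 1" "t \<ge> 0"
  shows "x (Suc n) t < x n t"
proof (cases "t = 0")
  case True
  then show ?thesis using assms by (simp add: tasep_path_def ordered_def)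
next
  case False
  then have "t > 0" using assms by simp
  have cad: "cadlag (x m)" "x m 0 = v m" if "m \<ge> 1" for m
    using assms(1) that by (auto simp: tasep_path_def)
  have rule: "x m s = (if N m s \<noteq> left_limit (N m) s
       \<and> (\<forall>j\<ge>1. left_limit (x j) s \<noteq> left_limit (x m) s + 1) \<and> A s (left_limit (x m) s + 1)
       then left_limit (x m) s + 1 else left_limit (x m) s)" if "m \<ge> 1" "s > 0" for m s
    using assms(1) that unfolding tasep_path_def Let_def by blast
  let ?G = "\<lambda>t. (x n t, x (Suc n) t)"
  have "step_fun ?G" using assms(3) by (intro step_fun_Pair cadlag_imp_step_fun cad) auto
  have "\<exists>L. (\<forall>l<L. \<exists>u. mesh t L l < u \<and> u \<le> mesh t L (Suc l) \<and>
    (\<forall>s. mesh t L l \<le> s \<and> s \<le> mesh t L (Suc l) \<longrightarrow>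
       ?G s = (if s < u then ?G (mesh t L l) else ?G (mesh t L (Suc l))))) \<and> 0 < L"
    by (rule eventually_happens'[OF sequentially_bot
          eventually_conj[OF step_fun_mesh[OF \<open>step_fun ?G\<close> \<open>t > 0\<close>] eventually_gt_at_top]])
  then obtain L where L: "L > 0" and cell: "\<And>l. l < L \<Longrightarrow> \<exists>u. mesh t L l < u \<and> u \<le> mesh t L (Suc l) \<and>
    (\<forall>s. mesh t L l \<le> s \<and> s \<le> mesh t L (Suc l) \<longrightarrow>
       ?G s = (if s < u then ?G (mesh t L l) else ?G (mesh t L (Suc l))))"
    by blast
  have "x (Suc n) (mesh t L k) < x n (mesh t L k)" if "k \<le> L" for k
    using that
  proof (induction k)
    case 0
    then show ?case using cad assms by (simp add: ordered_def)
  next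
    case (Suc k)
    define a b where "a = mesh t L k" and "b = mesh t L (Suc k)"
    obtain u where u: "a < u" "u \<le> b"
      and Gu: "\<And>s. a \<le> s \<Longrightarrow> s \<le> b \<Longrightarrow> ?G s = (if s < u then ?G a else ?G b)"
      using cell[of k] Suc.prems unfolding a_def b_def by auto
    have "a \<ge> 0" using \<open>t > 0\<close> by (simp add: a_def)
    then have "u > 0" using u by simp
    have below: "x n s = x n a \<and> x (Suc n) s = x (Suc n) a" if "a \<le> s" "s < u" for s
      using Gu[of s] that u by simp
    have ll: "left_limit (x n) u = x n a" "left_limit (x (Suc n)) u = x (Suc n) a"
      by (rule left_limit_eqI[OF u(1)], use below in blast)+
    have ub: "x n b = x n u" "x (Suc n) b = x (Suc n) u"
      using Gu[of u] u by simp_all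
    have "x (Suc n) a < x n a" using Suc by (simp add: a_def)
    then have "x (Suc n) u < x n u"
      using rule[of n u] rule[of "Suc n" u] assms(3) \<open>u > 0\<close> ll by (auto split: if_splits)
    then show ?case using ub by (simp add: b_def)
  qed
  from this[of L] show ?thesis using L by simp
qed

text \<open>Labels beyond \<open>n\<close> are cut off: particles are influenced only by those
  ahead, which have smaller labels. The ring pattern is thereby a finite object.\<close>

definition rings :: "nat \<Rightarrow> real \<Rightarrow> (nat \<Rightarrow> real \<Rightarrow> nat) \<Rightarrow> nat \<Rightarrow> (nat \<times> nat) set" where
  "rings n T N L = {(i, l). i \<in> {1..n} \<and> l < L \<and> N i (mesh T L l) \<noteq> N i (mesh T L (Suc l))}"

text \<open>On a fine mesh all changes inside a cell happen at one common time \<open>u\<close>, so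
  the rule at \<open>u\<close> is one parallel update. How fine the mesh must be depends on the
  path.\<close>

lemma tasep_path_eq_grid:
  assumes path: "tasep_path A N v x" and v: "ordered v"
    and N: "\<And>i. i \<ge> 1 \<Longrightarrow> cadlag (N i)" and A: "step_fun A" and T: "T > 0"
  shows "\<forall>\<^sub>F L in sequentially. \<forall>k\<le>L. \<forall>i\<in>{1..n}.
    x i (mesh T L k) = grid (\<lambda>l. A (mesh T L (Suc l))) (rings n T N L) v k i"
proof -
  have cad: "cadlag (x m)" "x m 0 = v m" if "m \<ge> 1" for m
    using path that by (auto simp: tasep_path_def)
  have rule: "x m s = (if N m s \<noteq> left_limit (N m) s
       \<and> (\<forall>j\<ge>1. left_limit (x j) s \<noteq> left_limit (x m) s + 1) \<and> A s (left_limit (x m) s + 1)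
       then left_limit (x m) s + 1 else left_limit (x m) s)" if "m \<ge> 1" "s > 0" for m s
    using path that unfolding tasep_path_def Let_def by blast
  have ll: "ordered (\<lambda>m. left_limit (x m) s)" if "s > 0" for s
    unfolding ordered_def using that cad tasep_path_less[OF path v]
    by (auto intro!: left_limit_less)
  \<comment> \<open>Order preservation: the only particle that can block \<open>m\<close> is \<open>m - 1\<close>.\<close>
  have block: "(\<forall>j\<ge>1. left_limit (x j) s \<noteq> left_limit (x m) s + 1) \<longleftrightarrow>
      m = 1 \<or> left_limit (x m) s + 1 \<noteq> left_limit (x (m - 1)) s" if "m \<ge> 1" "s > 0" for m s
  proof
    assume R: "m = 1 \<or> left_limit (x m) s + 1 \<noteq> left_limit (x (m - 1)) s"
    show "\<forall>j\<ge>1. left_limit (x j) s \<noteq> left_limit (x m) s + 1"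
    proof (intro allI impI)
      fix j :: nat assume j: "j \<ge> 1"
      consider "j = m" | "j > m" | "j = m - 1" "m > 1" | "j < m - 1" "m > 1" using j by linarith
      then show "left_limit (x j) s \<noteq> left_limit (x m) s + 1"
      proof cases
        case 2
        then show ?thesis using ordered_less[OF ll[OF that(2)] that(1) 2] by simp
      next
        case 4
        have "left_limit (x (m - 1)) s < left_limit (x j) s"
          using ordered_less[OF ll[OF that(2)] j 4(1)] .
        moreover have "left_limit (x m) s < left_limit (x (m - 1)) s"
          using ordered_less[OF ll[OF that(2)], of "m - 1" m] 4 by simp
        ultimately show ?thesis by linarith
      qed (use R in auto)
    qed
  next
    assume L: "\<forall>j\<ge>1. left_limit (x j) s \<noteq> left_limit (x m) s + 1"
    show "m = 1 \<or> left_limit (x m) s + 1 \<noteq> left_limit (x (m - 1)) s"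
    proof (cases "m = 1")
      case False
      then have "1 \<le> m - 1" using that by simp
      then show ?thesis using L by metis
    qed simp
  qed
  \<comment> \<open>Bundling positions, clocks and wall into one path gives them a common change
    time in each cell.\<close>
  let ?G = "\<lambda>t. ((\<lambda>i\<in>{1..n}. x i t), (\<lambda>i\<in>{1..n}. N i t), A t)"
  have "step_fun (\<lambda>t. \<lambda>i\<in>{1..n}. x i t)"
    by (rule step_fun_restrict, simp, rule cadlag_imp_step_fun, rule cad(1), simp)
  moreover have "step_fun (\<lambda>t. \<lambda>i\<in>{1..n}. N i t)"
    by (rule step_fun_restrict, simp, rule cadlag_imp_step_fun, rule N, simp)
  ultimately have "step_fun ?G"
    by (intro step_fun_Pair A)
  from step_fun_mesh[OF this T] show ?thesis
  proof eventually_elim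
    case (elim L)
    have "\<forall>i\<in>{1..n}. x i (mesh T L k) =
      grid (\<lambda>l. A (mesh T L (Suc l))) (rings n T N L) v k i" if "k \<le> L" for k
      using that
    proof (induction k)
      case 0
      then show ?case using cad by simp
    next
      case (Suc k)
      define a b where "a = mesh T L k" and "b = mesh T L (Suc k)"
      obtain u where u: "a < u" "u \<le> b"
        and Gu: "\<And>s. a \<le> s \<Longrightarrow> s \<le> b \<Longrightarrow> ?G s = (if s < u then ?G a else ?G b)"
        using elim Suc.prems unfolding a_def b_def by (meson Suc_le_lessD)
      have xu: "x i s = (if s < u then x i a else x i b)" "N i s = (if s < u then N i a else N i b)"
        if "i \<in> {1..n}" "a \<le> s" "s \<le> b" for i s
      proof -
        have "restrict (\<lambda>i. x i s) {1..n} = restrict (\<lambda>i. x i (if s < u then a else b)) {1..n}"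
          and "restrict (\<lambda>i. N i s) {1..n} = restrict (\<lambda>i. N i (if s < u then a else b)) {1..n}"
          using Gu[OF that(2,3)] by (simp_all split: if_splits)
        from this[THEN fun_cong, of i]
        show "x i s = (if s < u then x i a else x i b)" "N i s = (if s < u then N i a else N i b)"
          using that(1) by (simp_all split: if_splits)
      qed
      \<comment> \<open>A jump at \<open>u\<close> sees the wall of the right end of the cell, hence
        the index \<open>Suc l\<close> in the grid.\<close>
      have Au: "A u = A b" using Gu[of u] u by auto
      have "a \<ge> 0" using T by (simp add: a_def)
    then have "u > 0" using u by simp
      have below: "x i s = x i a" "N i s = N i a" if "i \<in> {1..n}" "a \<le> s" "s < u" for i s
        using xu[of i s] that u by simp_all
      have llx: "left_limit (x i) u = x i a" "left_limit (N i) u = N i a" if "i \<in> {1..n}" for i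
        by (rule left_limit_eqI[OF u(1)], use below that in blast)+
      have IH: "x i a = grid (\<lambda>l. A (mesh T L (Suc l))) (rings n T N L) v k i" if "i \<in> {1..n}" for i
        using Suc that unfolding a_def by simp
      show ?case
      proof
        fix i assume i: "i \<in> {1..n}"
        have i1: "1 \<le> i" "i = 1 \<or> i - 1 \<in> {1..n}" using i by auto
        have ring: "N i b \<noteq> N i a \<longleftrightarrow> (i, k) \<in> rings n T N L"
          using i Suc.prems by (auto simp: rings_def a_def b_def)
        have blocked: "(\<forall>j\<ge>1. left_limit (x j) u \<noteq> x i a + 1) \<longleftrightarrow> i = 1 \<or> x i a + 1 \<noteq> x (i - 1) a"
          using block[OF i1(1) \<open>u > 0\<close>] i1(2) llx(1)[of "i - 1"] unfolding llx(1)[OF i] by metis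
        have xb: "x i b = x i u" "N i u = N i b"
          using xu[OF i, of u] u by simp_all
        have "x i b = (if (i, k) \<in> rings n T N L \<and>
            (i = 1 \<or> x i a + 1 \<noteq> x (i - 1) a) \<and> A b (x i a + 1) then x i a + 1 else x i a)"
          using rule[OF i1(1) \<open>u > 0\<close>] unfolding llx[OF i] Au xb(2) ring blocked xb(1) .
        moreover have "i = 1 \<or> x (i - 1) a =
            grid (\<lambda>l. A (mesh T L (Suc l))) (rings n T N L) v k (i - 1)"
          using IH i1(2) by blast
        ultimately show "x i (mesh T L (Suc k)) =
            grid (\<lambda>l. A (mesh T L (Suc l))) (rings n T N L) v (Suc k) i"
          unfolding grid.simps Let_def IH[OF i, symmetric] b_def by (elim disjE) simp_all
      qed
    qed
    then show ?case by blast
  qed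
qed

section \<open>The joint law of the rings in the mesh cells\<close>

text \<open>\<open>B\<close> is the lower limit of the events \<open>E L\<close>, hence measurable,
  and dominated convergence applies to the indicators. The threshold for \<open>L\<close> may vary
  with the outcome.\<close>

lemma (in finite_measure) measure_tendsto_eventually_mem:
  assumes E: "\<And>L. E L \<in> sets M" and B: "B \<subseteq> space M"
    and ev: "\<And>\<omega>. \<omega> \<in> space M \<Longrightarrow> \<forall>\<^sub>F L in sequentially. \<omega> \<in> E L \<longleftrightarrow> \<omega> \<in> B"
  shows "B \<in> sets M" and "(\<lambda>L. measure M (E L)) \<longlonglongrightarrow> measure M B"
proof -
  have "B = (\<Union>L0. \<Inter>L\<in>{L0..}. E L)"
  proof (intro equalityI subsetI)
    fix \<omega> assume "\<omega> \<in> B"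
    then have "\<forall>\<^sub>F L in sequentially. \<omega> \<in> E L"
      using ev[of \<omega>] B by (auto elim: eventually_mono)
    then show "\<omega> \<in> (\<Union>L0. \<Inter>L\<in>{L0..}. E L)"
      by (auto simp: eventually_sequentially)
  next
    fix \<omega> assume "\<omega> \<in> (\<Union>L0. \<Inter>L\<in>{L0..}. E L)"
    then obtain L0 where L0: "\<forall>L\<ge>L0. \<omega> \<in> E L" by auto
    then have "\<omega> \<in> space M" using sets.sets_into_space[OF E] by blast
    from eventually_conj[OF ev[OF this] eventually_ge_at_top[of L0]]
    obtain L where "\<omega> \<in> E L \<longleftrightarrow> \<omega> \<in> B" "L \<ge> L0"
      using eventually_happens'[OF sequentially_bot] by blast
    then show "\<omega> \<in> B" using L0 by blast
  qed
  then show "B \<in> sets M" using E by auto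
  then have [measurable]: "B \<in> sets M" "\<And>L. E L \<in> sets M" using E by auto
  have "(\<lambda>L. \<integral>\<omega>. indicat_real (E L) \<omega> \<partial>M) \<longlonglongrightarrow> (\<integral>\<omega>. indicat_real B \<omega> \<partial>M)"
  proof (rule integral_dominated_convergence[where w = "\<lambda>_. 1"])
    show "AE \<omega> in M. (\<lambda>L. indicat_real (E L) \<omega>) \<longlonglongrightarrow> indicat_real B \<omega>"
    proof (rule AE_I2)
      fix \<omega> assume "\<omega> \<in> space M"
      then have "\<forall>\<^sub>F L in sequentially. indicat_real (E L) \<omega> = indicat_real B \<omega>"
        using ev[of \<omega>] by (auto elim!: eventually_mono simp: indicator_def)
      then show "(\<lambda>L. indicat_real (E L) \<omega>) \<longlonglongrightarrow> indicat_real B \<omega>"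
        by (rule tendsto_eventually)
    qed
  qed (auto simp: indicator_def)
  then show "(\<lambda>L. measure M (E L)) \<longlonglongrightarrow> measure M B" by simp
qed

lemma differ_measurable:
  fixes g h :: "'w \<Rightarrow> nat"
  assumes "g \<in> measurable M (count_space UNIV)" "h \<in> measurable M (count_space UNIV)"
  shows "{\<omega> \<in> space M. (g \<omega> \<noteq> h \<omega>) \<longleftrightarrow> b} \<in> sets M"
proof -
  have "{\<omega> \<in> space M. g \<omega> = h \<omega>} = (\<Union>k. (g -` {k} \<inter> space M) \<inter> (h -` {k} \<inter> space M))"
    by auto
  also have "\<dots> \<in> sets M"
    using assms by (intro sets.countable_UN' sets.Int measurable_sets) auto
  finally have eq: "{\<omega> \<in> space M. g \<omega> = h \<omega>} \<in> sets M" .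
  moreover have "{\<omega> \<in> space M. g \<omega> \<noteq> h \<omega>} = space M - {\<omega> \<in> space M. g \<omega> = h \<omega>}"
    by auto
  ultimately show ?thesis by (cases b) auto
qed

lemma clock_measurable:
  assumes "independent_poisson_clocks M N" "i \<ge> 1" "t \<ge> 0"
  shows "(\<lambda>\<omega>. N i t \<omega>) \<in> measurable M (count_space UNIV)"
proof -
  have "poisson_process M (N i)"
    using assms(1,2) unfolding independent_poisson_clocks_def by simp
  then show ?thesis using assms(3) unfolding poisson_process_def by simp
qed

abbreviation clock_rings ::
  "nat \<Rightarrow> real \<Rightarrow> nat \<Rightarrow> (nat \<Rightarrow> real \<Rightarrow> 'w \<Rightarrow> nat) \<Rightarrow> 'w \<Rightarrow> (nat \<times> nat) set" where
  "clock_rings n T L N \<omega> \<equiv> rings n T (\<lambda>i t. N i t \<omega>) L"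

lemma rings_subset: "rings n T N L \<subseteq> {1..n} \<times> {..<L}"
  by (auto simp: rings_def)

lemma poisson_no_ring:
  assumes "prob_space M" "poisson_process M N" "0 \<le> s" "s < t"
  shows "measure M {\<omega> \<in> space M. N s \<omega> = N t \<omega>} = exp (- (t - s))"
proof -
  have [measurable]: "N s \<in> measurable M (count_space UNIV)" "N t \<in> measurable M (count_space UNIV)"
    using assms by (auto simp: poisson_process_def)
  \<comment> \<open>Subtraction on \<open>nat\<close> truncates, so a zero difference means equality
    only by monotonicity.\<close>
  have "N s \<omega> \<le> N t \<omega>" if "\<omega> \<in> space M" for \<omega>
    using assms that by (auto simp: poisson_process_def mono_on_def)
  then have "{\<omega> \<in> space M. N s \<omega> = N t \<omega>} = (\<lambda>\<omega>. N t \<omega> - N s \<omega>) -` {0} \<inter> space M"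
    by force
  then have "measure M {\<omega> \<in> space M. N s \<omega> = N t \<omega>} =
      measure (distr M (count_space UNIV) (\<lambda>\<omega>. N t \<omega> - N s \<omega>)) {0}"
    by (subst measure_distr) auto
  also have "distr M (count_space UNIV) (\<lambda>\<omega>. N t \<omega> - N s \<omega>) = measure_pmf (poisson_pmf (t - s))"
    using assms by (auto simp: poisson_process_def)
  also have "measure (measure_pmf (poisson_pmf (t - s))) {0} = exp (- (t - s))"
    using assms by (simp add: measure_pmf_single)
  finally show ?thesis .
qed

text \<open>The joint law of independent Bernoulli variables, one per label and cell; a clock stays
  silent during a cell of length \<open>T / L\<close> with probability
  \<open>exp (- (T / L))\<close>.\<close>

definition rings_weight :: "nat \<Rightarrow> real \<Rightarrow> nat \<Rightarrow> (nat \<times> nat) set \<Rightarrow> real" where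
  "rings_weight n T L R =
     (\<Prod>x\<in>{1..n} \<times> {..<L}. if x \<in> R then 1 - exp (- (T / real L)) else exp (- (T / real L)))"

lemma single_clock_rings_prob:
  assumes M: "prob_space M" and N: "poisson_process M N" and "T > 0" "L > 0"
  shows "measure M {\<omega> \<in> space M. \<forall>l<L. (N (mesh T L l) \<omega> \<noteq> N (mesh T L (Suc l)) \<omega>) \<longleftrightarrow> l \<in> R} =
    (\<Prod>l<L. if l \<in> R then 1 - exp (- (T / real L)) else exp (- (T / real L)))"
proof -
  interpret prob_space M by (rule M)
  let ?X = "\<lambda>l \<omega>. N (mesh T L (Suc l)) \<omega> - N (mesh T L l) \<omega>"
  let ?A = "\<lambda>l. if l \<in> R then - {0::nat} else {0}"
  have meshes: "0 \<le> mesh T L l" "mesh T L l < mesh T L (Suc l)" for l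
    using assms by (auto simp: divide_strict_right_mono)
  have N_meas: "N (mesh T L l) \<in> measurable M (count_space UNIV)" for l
    using N meshes(1)[of l] unfolding poisson_process_def by simp
  have mono: "N (mesh T L l) \<omega> \<le> N (mesh T L (Suc l)) \<omega>" if "\<omega> \<in> space M" for l \<omega>
  proof -
    have "mono_on {0..} (\<lambda>t. N t \<omega>)" using N that unfolding poisson_process_def by blast
    then show ?thesis
      using meshes[of l] meshes(1)[of "Suc l"] by (auto intro: mono_onD simp del: of_nat_Suc)
  qed
  have X0: "?X l \<omega> = 0 \<longleftrightarrow> N (mesh T L l) \<omega> = N (mesh T L (Suc l)) \<omega>" if "\<omega> \<in> space M" for l \<omega>
    using mono[OF that, of l] by linarith
  have "mono (mesh T L)"
    by (rule monoI) (use assms in \<open>auto intro!: divide_right_mono mult_right_mono\<close>)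
  moreover have "\<forall>(u :: nat \<Rightarrow> real) k. 0 \<le> u 0 \<and> mono u \<longrightarrow>
      indep_vars (\<lambda>_. count_space UNIV) (\<lambda>i \<omega>. N (u (Suc i)) \<omega> - N (u i) \<omega>) {..<k}"
    using N unfolding poisson_process_def by (elim conjE) assumption
  ultimately have indep: "indep_vars (\<lambda>_. count_space UNIV) ?X {..<L}"
    using meshes(1)[of 0] by (elim allE[of _ "mesh T L"] allE[of _ L] impE) (rule conjI)
  have "{\<omega> \<in> space M. \<forall>l<L. (N (mesh T L l) \<omega> \<noteq> N (mesh T L (Suc l)) \<omega>) \<longleftrightarrow> l \<in> R} =
      (\<Inter>l\<in>{..<L}. ?X l -` ?A l \<inter> space M)"
  proof (intro equalityI subsetI)
    fix \<omega> assume "\<omega> \<in> {\<omega> \<in> space M. \<forall>l<L. (N (mesh T L l) \<omega> \<noteq> N (mesh T L (Suc l)) \<omega>) \<longleftrightarrow> l \<in> R}"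
    then show "\<omega> \<in> (\<Inter>l\<in>{..<L}. ?X l -` ?A l \<inter> space M)"
      using X0[of \<omega>] by auto
  next
    fix \<omega> assume \<omega>: "\<omega> \<in> (\<Inter>l\<in>{..<L}. ?X l -` ?A l \<inter> space M)"
    then have "\<omega> \<in> ?X 0 -` ?A 0 \<inter> space M" using assms(4) by blast
    then have "\<omega> \<in> space M" by blast
    moreover have "(N (mesh T L l) \<omega> \<noteq> N (mesh T L (Suc l)) \<omega>) \<longleftrightarrow> l \<in> R" if "l < L" for l
    proof -
      have "?X l \<omega> \<in> ?A l" using \<omega> that by blast
      then have "?X l \<omega> \<noteq> 0 \<longleftrightarrow> l \<in> R" by (auto split: if_splits)
      then show ?thesis using X0[OF \<open>\<omega> \<in> space M\<close>, of l] by argo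
    qed
    ultimately show "\<omega> \<in> {\<omega> \<in> space M. \<forall>l<L. (N (mesh T L l) \<omega> \<noteq> N (mesh T L (Suc l)) \<omega>) \<longleftrightarrow> l \<in> R}"
      by blast
  qed
  then have "measure M {\<omega> \<in> space M. \<forall>l<L. (N (mesh T L l) \<omega> \<noteq> N (mesh T L (Suc l)) \<omega>) \<longleftrightarrow> l \<in> R} =
      prob (\<Inter>l\<in>{..<L}. ?X l -` ?A l \<inter> space M)" by simp
  also have "\<dots> = (\<Prod>l\<in>{..<L}. prob (?X l -` ?A l \<inter> space M))"
    by (rule indep_varsD_finite[OF indep]) (use assms in auto)
  also have "\<dots> = (\<Prod>l<L. if l \<in> R then 1 - exp (- (T / real L)) else exp (- (T / real L)))"
  proof (rule prod.cong[OF refl])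
    fix l
    have "mesh T L (Suc l) - mesh T L l = T / real L"
      by (simp add: add_divide_distrib algebra_simps)
    then have p: "prob {\<omega> \<in> space M. N (mesh T L l) \<omega> = N (mesh T L (Suc l)) \<omega>} = exp (- (T / real L))"
      using poisson_no_ring[OF M N meshes[of l]] by simp
    have Z: "?X l -` {0} \<inter> space M = {\<omega> \<in> space M. N (mesh T L l) \<omega> = N (mesh T L (Suc l)) \<omega>}"
      using X0[of _ l] by blast
    have Z_sets: "?X l -` {0} \<inter> space M \<in> sets M"
      using differ_measurable[OF N_meas[of l] N_meas[of "Suc l"], of False]
      unfolding Z by (simp del: of_nat_Suc)
    have "?X l -` (- {0}) \<inter> space M = space M - (?X l -` {0} \<inter> space M)" by blast
    then show "prob (?X l -` ?A l \<inter> space M) =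
        (if l \<in> R then 1 - exp (- (T / real L)) else exp (- (T / real L)))"
      using prob_compl[OF Z_sets] p unfolding Z by (cases "l \<in> R") (simp_all only: if_True if_False Z)
  qed
  finally show ?thesis .
qed

lemma clock_rings_prob:
  assumes M: "prob_space M" and N: "independent_poisson_clocks M N"
    and "T > 0" "L > 0" "n \<ge> 1" "R \<subseteq> {1..n} \<times> {..<L}"
  shows "measure M {\<omega> \<in> space M. clock_rings n T L N \<omega> = R} = rings_weight n T L R"
proof -
  interpret prob_space M by (rule M)
  let ?P = "Pi\<^sub>M {0..} (\<lambda>_. count_space UNIV) :: (real \<Rightarrow> nat) measure"
  let ?Y = "\<lambda>i \<omega>. \<lambda>t\<in>{0..}. N i t \<omega>"
  \<comment> \<open>Independence of the clocks is given for whole paths in an uncountable product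
    space; this event involves finitely many coordinates and is measurable there.\<close>
  let ?B = "\<lambda>i. {g \<in> space ?P. \<forall>l\<in>{..<L}. (g (mesh T L l) \<noteq> g (mesh T L (Suc l))) \<longleftrightarrow> (i, l) \<in> R}"
  have meshes: "0 \<le> mesh T L l" for l using assms by simp
  have [measurable]: "(\<lambda>g. g (mesh T L l)) \<in> measurable ?P (count_space UNIV)" for l
    using meshes by (intro measurable_component_singleton) simp
  have B: "?B i \<in> sets ?P" for i
  proof (rule sets.sets_Collect_finite_All)
    fix l
    show "{g \<in> space ?P. (g (mesh T L l) \<noteq> g (mesh T L (Suc l))) \<longleftrightarrow> (i, l) \<in> R} \<in> sets ?P"
      by (rule differ_measurable) measurable
  qed simp
  have ind: "indep_vars (\<lambda>_. ?P) ?Y {1..}"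
    using N unfolding independent_poisson_clocks_def by blast
  have Y: "?Y i -` ?B i \<inter> space M =
      {\<omega> \<in> space M. \<forall>l<L. (N i (mesh T L l) \<omega> \<noteq> N i (mesh T L (Suc l)) \<omega>) \<longleftrightarrow> l \<in> {l. (i, l) \<in> R}}" for i
  proof -
    have "?Y i \<omega> \<in> space ?P" for \<omega> by (auto simp: space_PiM)
    then show ?thesis using meshes by (auto simp del: of_nat_Suc)
  qed
  have "{\<omega> \<in> space M. clock_rings n T L N \<omega> = R} = (\<Inter>i\<in>{1..n}. ?Y i -` ?B i \<inter> space M)"
    unfolding Y
  proof (intro equalityI subsetI)
    fix \<omega> assume "\<omega> \<in> {\<omega> \<in> space M. clock_rings n T L N \<omega> = R}"
    then have "\<omega> \<in> space M" "R = clock_rings n T L N \<omega>" by blast+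
    then show "\<omega> \<in> (\<Inter>i\<in>{1..n}. {\<omega> \<in> space M. \<forall>l<L.
        (N i (mesh T L l) \<omega> \<noteq> N i (mesh T L (Suc l)) \<omega>) \<longleftrightarrow> l \<in> {l. (i, l) \<in> R}})"
      unfolding rings_def by blast
  next
    fix \<omega> assume \<omega>: "\<omega> \<in> (\<Inter>i\<in>{1..n}. {\<omega> \<in> space M. \<forall>l<L.
        (N i (mesh T L l) \<omega> \<noteq> N i (mesh T L (Suc l)) \<omega>) \<longleftrightarrow> l \<in> {l. (i, l) \<in> R}})"
    have "1 \<in> {1..n}" using assms(5) by simp
    then have "\<omega> \<in> space M" using \<omega> by blast
    moreover have "clock_rings n T L N \<omega> = R"
      using \<omega> assms(6) unfolding rings_def by blast
    ultimately show "\<omega> \<in> {\<omega> \<in> space M. clock_rings n T L N \<omega> = R}" by blast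
  qed
  then have "prob {\<omega> \<in> space M. clock_rings n T L N \<omega> = R} =
      prob (\<Inter>i\<in>{1..n}. ?Y i -` ?B i \<inter> space M)" by simp
  also have "\<dots> = (\<Prod>i\<in>{1..n}. prob (?Y i -` ?B i \<inter> space M))"
    by (rule indep_varsD[OF ind _ _ _ B]) (use assms(5) in auto)
  also have "\<dots> = (\<Prod>i\<in>{1..n}. \<Prod>l<L. if (i, l) \<in> R then 1 - exp (- (T / real L)) else exp (- (T / real L)))"
  proof (rule prod.cong[OF refl])
    fix i assume "i \<in> {1..n}"
    then have "poisson_process M (N i)" using N unfolding independent_poisson_clocks_def by simp
    from single_clock_rings_prob[OF M this assms(3,4), of "{l. (i, l) \<in> R}"]
    show "prob (?Y i -` ?B i \<inter> space M) =
        (\<Prod>l<L. if (i, l) \<in> R then 1 - exp (- (T / real L)) else exp (- (T / real L)))"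
      unfolding Y by simp
  qed
  also have "\<dots> = rings_weight n T L R"
    unfolding rings_weight_def prod.cartesian_product by (rule prod.cong) auto
  finally show ?thesis .
qed

lemma clock_rings_measurable:
  assumes N: "independent_poisson_clocks M N" and "T > 0"
  shows "{\<omega> \<in> space M. Q (clock_rings n T L N \<omega>)} \<in> sets M"
proof -
  let ?G = "{1..n} \<times> {..<L}"
  have single: "{\<omega> \<in> space M. clock_rings n T L N \<omega> = R} \<in> sets M" if "R \<subseteq> ?G" for R
  proof -
    have "{\<omega> \<in> space M. clock_rings n T L N \<omega> = R} =
        {\<omega> \<in> space M. \<forall>x\<in>?G. (N (fst x) (mesh T L (snd x)) \<omega> \<noteq> N (fst x) (mesh T L (Suc (snd x))) \<omega>) \<longleftrightarrow> x \<in> R}"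
      using that unfolding rings_def by fastforce
    also have "\<dots> \<in> sets M"
    proof (rule sets.sets_Collect_finite_All)
      fix x assume "x \<in> ?G"
      then have "N (fst x) (mesh T L l) \<in> measurable M (count_space UNIV)" for l
        using assms by (intro clock_measurable[OF N]) auto
      then show "{\<omega> \<in> space M. (N (fst x) (mesh T L (snd x)) \<omega> \<noteq> N (fst x) (mesh T L (Suc (snd x))) \<omega>) \<longleftrightarrow> x \<in> R} \<in> sets M"
        by (intro differ_measurable)
    qed simp
    finally show ?thesis .
  qed
  have "{\<omega> \<in> space M. Q (clock_rings n T L N \<omega>)} =
      (\<Union>R\<in>{R \<in> Pow ?G. Q R}. {\<omega> \<in> space M. clock_rings n T L N \<omega> = R})"
    using rings_subset[of n T _ L] by auto
  also have "\<dots> \<in> sets M"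
    using single by (intro sets.finite_UN) auto
  finally show ?thesis .
qed

text \<open>The right side does not mention \<open>N\<close>, so ring events of processes driven by
  different clocks can be transferred to one common family.\<close>

lemma clock_rings_law:
  assumes M: "prob_space M" and N: "independent_poisson_clocks M N"
    and "T > 0" "L > 0" "n \<ge> 1"
  shows "measure M {\<omega> \<in> space M. Q (clock_rings n T L N \<omega>)} =
    (\<Sum>R | R \<subseteq> {1..n} \<times> {..<L} \<and> Q R. rings_weight n T L R)"
proof -
  interpret prob_space M by (rule M)
  let ?G = "{1..n} \<times> {..<L}"
  have "{\<omega> \<in> space M. Q (clock_rings n T L N \<omega>)} =
      (\<Union>R\<in>{R. R \<subseteq> ?G \<and> Q R}. {\<omega> \<in> space M. clock_rings n T L N \<omega> = R})"
    using rings_subset[of n T _ L] by auto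
  then have "prob {\<omega> \<in> space M. Q (clock_rings n T L N \<omega>)} =
      prob (\<Union>R\<in>{R. R \<subseteq> ?G \<and> Q R}. {\<omega> \<in> space M. clock_rings n T L N \<omega> = R})" by simp
  also have "\<dots> = (\<Sum>R\<in>{R. R \<subseteq> ?G \<and> Q R}. prob {\<omega> \<in> space M. clock_rings n T L N \<omega> = R})"
  proof (rule finite_measure_finite_Union)
    show "finite {R. R \<subseteq> ?G \<and> Q R}" by simp
    show "(\<lambda>R. {\<omega> \<in> space M. clock_rings n T L N \<omega> = R}) ` {R. R \<subseteq> ?G \<and> Q R} \<subseteq> sets M"
      using clock_rings_measurable[OF N assms(3)] by auto
    show "disjoint_family_on (\<lambda>R. {\<omega> \<in> space M. clock_rings n T L N \<omega> = R}) {R. R \<subseteq> ?G \<and> Q R}"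
      by (auto simp: disjoint_family_on_def)
  qed
  also have "\<dots> = (\<Sum>R\<in>{R. R \<subseteq> ?G \<and> Q R}. rings_weight n T L R)"
    using clock_rings_prob[OF M N assms(3-5)] by (intro sum.cong) auto
  finally show ?thesis .
qed

section \<open>Invariance of the ring law under reversal\<close>

abbreviation reverse_cell :: "nat \<Rightarrow> nat \<Rightarrow> nat \<times> nat \<Rightarrow> nat \<times> nat" where
  "reverse_cell n L \<equiv> \<lambda>(i, l). (n + 1 - i, L - 1 - l)"

lemma reverse_cell_involution:
  "x \<in> {1..n} \<times> {..<L} \<Longrightarrow> reverse_cell n L (reverse_cell n L x) = x"
  "x \<in> {1..n} \<times> {..<L} \<Longrightarrow> reverse_cell n L x \<in> {1..n} \<times> {..<L}"
  by auto

text \<open>All cells have the same ring probability, so permuting them only reorders the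
  product.\<close>

lemma rings_weight_reverse:
  assumes "R \<subseteq> {1..n} \<times> {..<L}"
  shows "rings_weight n T L (reverse_cell n L ` R) = rings_weight n T L R"
proof -
  let ?G = "{1..n} \<times> {..<L}"
  let ?r = "reverse_cell n L"
  have "x \<in> ?r ` R \<longleftrightarrow> ?r x \<in> R" if "x \<in> ?G" for x
  proof
    assume "x \<in> ?r ` R"
    then obtain y where "y \<in> R" "x = ?r y" by (rule imageE)
    moreover from this have "?r (?r y) = y"
      using assms by (intro reverse_cell_involution(1)) (rule subsetD)
    ultimately show "?r x \<in> R" by (simp only:)
  next
    assume "?r x \<in> R"
    then have "?r (?r x) \<in> ?r ` R" by (rule imageI)
    then show "x \<in> ?r ` R" by (simp only: reverse_cell_involution(1)[OF that])
  qed
  then show ?thesis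
    unfolding rings_weight_def
    by (intro prod.reindex_bij_witness[of ?G ?r ?r])
      (simp_all only: reverse_cell_involution)
qed

lemma clock_rings_law_reverse:
  assumes M: "prob_space M" and N: "independent_poisson_clocks M N" and N': "independent_poisson_clocks M N'"
    and "T > 0" "L > 0" "n \<ge> 1"
  shows "measure M {\<omega> \<in> space M. Q (reverse_cell n L ` clock_rings n T L N \<omega>)} =
    measure M {\<omega> \<in> space M. Q (clock_rings n T L N' \<omega>)}"
proof -
  let ?G = "{1..n} \<times> {..<L}" and ?r = "image (reverse_cell n L)"
  have rr: "?r (?r R) = R" if "R \<subseteq> ?G" for R
  proof -
    have "?r (?r R) = id ` R"
      unfolding image_image using reverse_cell_involution(1) that by (intro image_cong) auto
    then show ?thesis by simp
  qed
  have rG: "?r R \<subseteq> ?G" if "R \<subseteq> ?G" for R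
    using that reverse_cell_involution(2) by blast
  show ?thesis
    unfolding clock_rings_law[OF M N assms(4-6), of "\<lambda>R. Q (?r R)"] clock_rings_law[OF M N' assms(4-6)]
    by (rule sum.reindex_bij_witness[of _ ?r ?r])
      (use rr rG rings_weight_reverse in \<open>auto simp del: image_subset_iff\<close>)
qed

text \<open>A violation at \<open>t\<close> is still seen at the next mesh point: \<open>X\<close>
  is constant shortly after \<open>t\<close>, while \<open>h (T - t)\<close> can only decrease as
  \<open>t\<close> grows, which raises the barrier.\<close>

lemma eventually_mesh_above_iff:
  fixes X :: "real \<Rightarrow> int" and h :: "real \<Rightarrow> real"
  assumes X: "cadlag X" and h: "mono_on {0..} h" and T: "T > 0"
  shows "\<forall>\<^sub>F L in sequentially. (\<forall>k\<le>L. c - h (mesh T L (L - k)) < real_of_int (X (mesh T L k))) \<longleftrightarrow>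
    (\<forall>t\<in>{0..T}. c - h (T - t) < real_of_int (X t))"
proof (cases "\<forall>t\<in>{0..T}. c - h (T - t) < real_of_int (X t)")
  case True
  show ?thesis
    using eventually_gt_at_top[of 0]
  proof eventually_elim
    case (elim L)
    have "c - h (mesh T L (L - k)) < real_of_int (X (mesh T L k))" if "k \<le> L" for k
    proof -
      have "mesh T L k \<in> {0..T}" "T - mesh T L k = mesh T L (L - k)"
        using that elim T by (auto simp: field_simps of_nat_diff)
      then show ?thesis using True by metis
    qed
    then show ?case using True by blast
  qed
next
  case False
  then obtain t where t: "0 \<le> t" "t \<le> T" and viol: "real_of_int (X t) \<le> c - h (T - t)"
    by (auto simp: not_less)
  obtain b where b: "t < b" and Xb: "\<And>s. t \<le> s \<Longrightarrow> s < b \<Longrightarrow> X s = X t"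
  proof -
    have "\<forall>\<^sub>F s in at_right t. X s = X t"
      using cadlag_imp_step_fun[OF X] t(1) by (simp add: step_fun_def)
    then obtain b where "t < b" "\<forall>s>t. s < b \<longrightarrow> X s = X t"
      by (auto simp: eventually_at_right_field)
    then show ?thesis by (intro that[of b]) (auto simp: le_less)
  qed
  have "(\<lambda>L. T / real L) \<longlonglongrightarrow> 0" by (rule lim_const_over_n)
  then have "\<forall>\<^sub>F L in sequentially. T / real L < b - t"
    using b by (intro order_tendstoD(2)) auto
  then show ?thesis
    using eventually_gt_at_top[of 0]
  proof eventually_elim
    case (elim L)
    \<comment> \<open>The first mesh point at or after \<open>t\<close>.\<close>
    define k where "k = nat \<lceil>t * real L / T\<rceil>"
    have "0 \<le> t * real L / T" using t T by simp
    then have k: "t * real L / T \<le> real k" "real k < t * real L / T + 1"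
      unfolding k_def by linarith+
    have "t * real L / T \<le> real L" using t T elim by (simp add: field_simps)
    then have kL: "k \<le> L" unfolding k_def by (simp add: nat_le_iff ceiling_le_iff)
    have kt: "t \<le> mesh T L k" using k(1) T elim by (simp add: field_simps)
    have "mesh T L k < t + T / real L" using k(2) T elim by (simp add: field_simps)
    then have kb: "mesh T L k < b" using elim by simp
    have Tk: "T - mesh T L k = mesh T L (L - k)" using kL elim T by (simp add: field_simps of_nat_diff)
    have "mesh T L (L - k) \<le> T - t" "0 \<le> mesh T L (L - k)"
      using kt Tk T by simp_all
    then have "h (mesh T L (L - k)) \<le> h (T - t)"
      using t by (intro mono_onD[OF h]) auto
    then have "\<not> c - h (mesh T L (L - k)) < real_of_int (X (mesh T L k))"
      using viol Xb[OF kt kb] by simp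
    then show ?case using kL False by blast
  qed
qed

section \<open>Comparison at a fixed time and the limit\<close>

lemma tasep_withE:
  assumes "tasep_with A M v X"
  obtains N where "independent_poisson_clocks M N"
    and "\<And>\<omega>. \<omega> \<in> space M \<Longrightarrow> tasep_path A (\<lambda>n t. N n t \<omega>) v (\<lambda>n t. X n t \<omega>)"
  using assms unfolding tasep_with_def by blast

lemma clock_cadlag:
  assumes "independent_poisson_clocks M N" "\<omega> \<in> space M" "i \<ge> 1"
  shows "cadlag (\<lambda>t. N i t \<omega>)"
proof -
  have "poisson_process M (N i)"
    using assms(1,3) unfolding independent_poisson_clocks_def by simp
  then show ?thesis using assms(2) unfolding poisson_process_def by simp
qed

text \<open>The event quantifies over uncountably many times; its measurability comes from being an
  eventual limit of mesh events.\<close>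

lemma above_wall_measurable_and_limit:
  fixes h :: "real \<Rightarrow> real" and c :: real
  assumes M: "prob_space M" and N: "independent_poisson_clocks M N"
    and path: "\<And>\<omega>. \<omega> \<in> space M \<Longrightarrow>
      tasep_path (\<lambda>_ _. True) (\<lambda>n t. N n t \<omega>) step_initial (\<lambda>n t. X n t \<omega>)"
    and h: "mono_on {0..} h" and T: "T > 0" and n: "n \<ge> 1"
  shows "{\<omega> \<in> space M. \<forall>t\<in>{0..T}. c - h (T - t) < real_of_int (X n t \<omega>)} \<in> sets M" (is "?B \<in> _")
    and "(\<lambda>L. measure M {\<omega> \<in> space M. \<forall>k\<le>L. c - h (mesh T L (L - k)) <
        real_of_int (free_grid (clock_rings n T L N \<omega>) step_initial k n)}) \<longlonglongrightarrow>
      measure M {\<omega> \<in> space M. \<forall>t\<in>{0..T}. c - h (T - t) < real_of_int (X n t \<omega>)}"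
      (is "(\<lambda>L. measure M (?E L)) \<longlonglongrightarrow> _")
proof -
  interpret prob_space M by (rule M)
  have E: "?E L \<in> sets M" for L
    by (rule clock_rings_measurable[OF N T, of "\<lambda>R. \<forall>k\<le>L. c - h (mesh T L (L - k)) <
        real_of_int (free_grid R step_initial k n)"])
  have ev: "\<forall>\<^sub>F L in sequentially. \<omega> \<in> ?E L \<longleftrightarrow> \<omega> \<in> ?B" if \<omega>: "\<omega> \<in> space M" for \<omega>
  proof -
    have "cadlag (\<lambda>t. X n t \<omega>)" using path[OF \<omega>] n by (simp add: tasep_path_def)
    have "\<forall>\<^sub>F L in sequentially. \<forall>k\<le>L. \<forall>i\<in>{1..n}.
        X i (mesh T L k) \<omega> = free_grid (clock_rings n T L N \<omega>) step_initial k i"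
      by (rule tasep_path_eq_grid[OF path[OF \<omega>] ordered_step_initial _ step_fun_const T])
        (rule clock_cadlag[OF N \<omega>])
    with eventually_mesh_above_iff[OF \<open>cadlag (\<lambda>t. X n t \<omega>)\<close> h T, of c]
    show ?thesis
    proof eventually_elim
      case (elim L)
      have "X n (mesh T L k) \<omega> = free_grid (clock_rings n T L N \<omega>) step_initial k n" if "k \<le> L" for k
        using elim(2) n that by simp
      then have "\<omega> \<in> ?E L \<longleftrightarrow> (\<forall>k\<le>L. c - h (mesh T L (L - k)) < real_of_int (X n (mesh T L k) \<omega>))"
        using \<omega> by simp
      then show ?case using elim(1) \<omega> by simp
    qed
  qed
  have "?B \<subseteq> space M" by blast
  from measure_tendsto_eventually_mem[OF E this ev]
  show "?B \<in> sets M" "(\<lambda>L. measure M (?E L)) \<longlonglongrightarrow> measure M ?B" by auto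
qed

lemma grid_measure_limit:
  assumes M: "prob_space M" and N: "independent_poisson_clocks M N"
    and path: "\<And>\<omega>. \<omega> \<in> space M \<Longrightarrow> tasep_path A (\<lambda>n t. N n t \<omega>) v (\<lambda>n t. X n t \<omega>)"
    and v: "ordered v" and A: "step_fun A" and T: "T > 0" and n: "n \<ge> 1"
  shows "(\<lambda>L. measure M {\<omega> \<in> space M.
      Q (grid (\<lambda>l. A (mesh T L (Suc l))) (clock_rings n T L N \<omega>) v L n)}) \<longlonglongrightarrow>
    measure M {\<omega> \<in> space M. Q (X n T \<omega>)}"
proof -
  interpret prob_space M by (rule M)
  let ?E = "\<lambda>L. {\<omega> \<in> space M. Q (grid (\<lambda>l. A (mesh T L (Suc l))) (clock_rings n T L N \<omega>) v L n)}"
  have E: "?E L \<in> sets M" for L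
    by (rule clock_rings_measurable[OF N T, of "\<lambda>R. Q (grid (\<lambda>l. A (mesh T L (Suc l))) R v L n)"])
  have ev: "\<forall>\<^sub>F L in sequentially. \<omega> \<in> ?E L \<longleftrightarrow> \<omega> \<in> {\<omega> \<in> space M. Q (X n T \<omega>)}"
    if \<omega>: "\<omega> \<in> space M" for \<omega>
  proof -
    have "\<forall>\<^sub>F L in sequentially. \<forall>k\<le>L. \<forall>i\<in>{1..n}. X i (mesh T L k) \<omega> =
        grid (\<lambda>l. A (mesh T L (Suc l))) (clock_rings n T L N \<omega>) v k i"
      by (rule tasep_path_eq_grid[OF path[OF \<omega>] v _ A T]) (rule clock_cadlag[OF N \<omega>])
    with eventually_gt_at_top[of 0] show ?thesis
    proof eventually_elim
      case (elim L)
      have "X n (mesh T L L) \<omega> = grid (\<lambda>l. A (mesh T L (Suc l))) (clock_rings n T L N \<omega>) v L n"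
        by (rule elim(2)[rule_format, OF order_refl]) (use n in simp)
      moreover have "mesh T L L = T" using elim(1) by simp
      ultimately show ?case using \<omega> by simp
    qed
  qed
  show ?thesis
    by (rule measure_tendsto_eventually_mem(2)[OF E _ ev]) blast
qed

text \<open>The three processes need not share clocks, so no pathwise comparison between them is
  available. Instead all three probabilities are written as limits of mesh probabilities under the
  single family \<open>Nf\<close>, where the minimum formula holds outcome by outcome.\<close>

proposition wall_comparison:
  fixes f :: "real \<Rightarrow> real" and s :: int
  assumes M: "prob_space M" and f: "wall f"
    and v: "ordered v" "v 1 \<le> 0"
    and xf: "tasep_wall f M v xf" and xt: "tasep M v xt" and x: "tasep M step_initial x"
    and T: "T > 0" and n: "n \<ge> 1"
  defines "a \<equiv> measure M {\<omega> \<in> space M. s < xf n T \<omega>}"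
    and "b \<equiv> measure M {\<omega> \<in> space M. \<forall>t\<in>{0..T}. s - \<lfloor>f (T - t)\<rfloor> < x n t \<omega>}"
    and "c \<equiv> measure M {\<omega> \<in> space M. xt n T \<omega> \<le> s}"
  shows "a \<le> b" and "b - c \<le> a"
proof -
  interpret prob_space M by (rule M)
  obtain Nf where Nf: "independent_poisson_clocks M Nf"
    and pf: "\<And>\<omega>. \<omega> \<in> space M \<Longrightarrow>
      tasep_path (\<lambda>t z. real_of_int z \<le> f t) (\<lambda>n t. Nf n t \<omega>) v (\<lambda>n t. xf n t \<omega>)"
    using xf unfolding tasep_wall_def by (rule tasep_withE) (rule that)
  obtain Nt where Nt: "independent_poisson_clocks M Nt"
    and pt: "\<And>\<omega>. \<omega> \<in> space M \<Longrightarrow>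
      tasep_path (\<lambda>_ _. True) (\<lambda>n t. Nt n t \<omega>) v (\<lambda>n t. xt n t \<omega>)"
    using xt unfolding tasep_def by (rule tasep_withE) (rule that)
  obtain Nx where Nx: "independent_poisson_clocks M Nx"
    and px: "\<And>\<omega>. \<omega> \<in> space M \<Longrightarrow>
      tasep_path (\<lambda>_ _. True) (\<lambda>n t. Nx n t \<omega>) step_initial (\<lambda>n t. x n t \<omega>)"
    using x unfolding tasep_def by (rule tasep_withE) (rule that)
  have f_mono: "mono_on {0..} f" and f_cont: "\<And>t. t \<ge> 0 \<Longrightarrow> continuous (at_right t) f" and f0: "f 0 = 0"
    using f unfolding wall_def cadlag_def by auto
  have floor_mono': "mono_on {0..} (\<lambda>t. real_of_int \<lfloor>f t\<rfloor>)"
    using f_mono unfolding mono_on_def by (simp add: floor_mono)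
  have wall_eq: "(\<lambda>z. real_of_int z \<le> f t) = (\<lambda>z. z \<le> \<lfloor>f t\<rfloor>)" for t
    by (simp add: le_floor_iff)
  have A: "step_fun (\<lambda>t z. real_of_int z \<le> f t)"
    unfolding wall_eq by (rule step_fun_compose[OF step_fun_floor[OF f_mono f_cont]])
  define w where "w L k = \<lfloor>f (mesh T L k)\<rfloor>" for L k
  have w_mono: "mono (w L)" for L
    unfolding w_def
    by (intro monoI floor_mono mono_onD[OF f_mono]) (use T in \<open>auto intro!: divide_right_mono mult_right_mono\<close>)
  have w0: "w L 0 = 0" for L by (simp add: w_def f0)
  define F where "F Q = (\<lambda>L. measure M {\<omega> \<in> space M. Q L (clock_rings n T L Nf \<omega>)})"
    for Q :: "nat \<Rightarrow> (nat \<times> nat) set \<Rightarrow> bool"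
  have F_sets: "{\<omega> \<in> space M. Q L (clock_rings n T L Nf \<omega>)} \<in> sets M"
    for Q :: "nat \<Rightarrow> (nat \<times> nat) set \<Rightarrow> bool" and L
    by (rule clock_rings_measurable[OF Nf T])

  have lim_a: "F (\<lambda>L R. s < wall_grid (w L) R v L n) \<longlonglongrightarrow> a"
    using grid_measure_limit[OF M Nf pf v(1) A T n, of "\<lambda>z. s < z"]
    unfolding F_def a_def w_def wall_eq .
  have "(\<lambda>L. measure M {\<omega> \<in> space M. free_grid (clock_rings n T L Nt \<omega>) v L n \<le> s}) \<longlonglongrightarrow> c"
    using grid_measure_limit[OF M Nt pt v(1) step_fun_const T n, of "\<lambda>z. z \<le> s"]
    unfolding c_def .
  moreover have "\<forall>\<^sub>F L in sequentially.
      measure M {\<omega> \<in> space M. free_grid (clock_rings n T L Nt \<omega>) v L n \<le> s} =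
      F (\<lambda>L R. free_grid R v L n \<le> s) L"
    using eventually_gt_at_top[of 0]
  proof eventually_elim
    case (elim L)
    show ?case
      unfolding F_def
      by (rule trans[OF clock_rings_law[OF M Nt T elim n] clock_rings_law[OF M Nf T elim n, symmetric]])
  qed
  ultimately have lim_c: "F (\<lambda>L R. free_grid R v L n \<le> s) \<longlonglongrightarrow> c"
    by (rule Lim_transform_eventually)
  have "(\<lambda>L. measure M {\<omega> \<in> space M. \<forall>k\<le>L. s - w L (L - k) <
      free_grid (clock_rings n T L Nx \<omega>) step_initial k n}) \<longlonglongrightarrow> b"
  proof -
    have int_real: "real_of_int s - real_of_int z < real_of_int y \<longleftrightarrow> s - z < y" for y z
      by linarith
    show ?thesis
      using above_wall_measurable_and_limit(2)[OF M Nx px floor_mono' T n, of "real_of_int s"]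
      unfolding b_def w_def int_real .
  qed
  moreover have "\<forall>\<^sub>F L in sequentially.
      measure M {\<omega> \<in> space M. \<forall>k\<le>L. s - w L (L - k) <
        free_grid (clock_rings n T L Nx \<omega>) step_initial k n} =
      F (\<lambda>L R. s < wall_grid (w L) R step_initial L n) L"
    using eventually_gt_at_top[of 0]
  proof eventually_elim
    case (elim L)
    let ?Q = "\<lambda>R. \<forall>k\<le>L. s - w L (L - k) < free_grid R step_initial k n"
    \<comment> \<open>A deterministic identity: the barrier event for reversed rings is the wall
      event from the step configuration. Invariance of the law then replaces \<open>Nx\<close> by
      \<open>Nf\<close>.\<close>
    have Q: "?Q (reverse_cell n L ` R) \<longleftrightarrow> s < wall_grid (w L) R step_initial L n"
      if R: "R \<subseteq> {1..n} \<times> {..<L}" for R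
    proof (rule wall_grid_greater_iff_reverse[OF w_mono w0 n, symmetric])
      fix i l :: nat assume "1 \<le> i" "i \<le> n" "l < L"
      then have il: "(i, l) \<in> {1..n} \<times> {..<L}" by simp
      show "(i, l) \<in> R \<longleftrightarrow> (n + 1 - i, L - 1 - l) \<in> reverse_cell n L ` R"
      proof
        assume "(i, l) \<in> R"
        then show "(n + 1 - i, L - 1 - l) \<in> reverse_cell n L ` R" by (rule rev_image_eqI) simp
      next
        assume "(n + 1 - i, L - 1 - l) \<in> reverse_cell n L ` R"
        then obtain y where y: "y \<in> R" "reverse_cell n L (i, l) = reverse_cell n L y" by auto
        have "y \<in> {1..n} \<times> {..<L}" using R y(1) by (rule subsetD)
        then have "y = (i, l)"
          by (metis reverse_cell_involution(1) il y(2))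
        then show "(i, l) \<in> R" using y(1) by simp
      qed
    qed
    have "measure M {\<omega> \<in> space M. ?Q (reverse_cell n L ` clock_rings n T L Nf \<omega>)} =
        F (\<lambda>L R. s < wall_grid (w L) R step_initial L n) L"
      unfolding F_def Q[OF rings_subset] ..
    then show ?case
      by (rule trans[OF clock_rings_law_reverse[OF M Nf Nx T elim n, of ?Q, symmetric]])
  qed
  ultimately have lim_b: "F (\<lambda>L R. s < wall_grid (w L) R step_initial L n) \<longlonglongrightarrow> b"
    by (rule Lim_transform_eventually)
  have grid_min: "wall_grid (w L) R v L n = min (free_grid R v L n) (wall_grid (w L) R step_initial L n)" for L R
    using w0[of L] by (intro wall_grid_eq_min v w_mono n) simp
  show "a \<le> b"
  proof (rule LIMSEQ_le[OF lim_a lim_b], intro exI allI impI)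
    fix L
    show "F (\<lambda>L R. s < wall_grid (w L) R v L n) L \<le> F (\<lambda>L R. s < wall_grid (w L) R step_initial L n) L"
      unfolding F_def using F_sets[of "\<lambda>L R. s < wall_grid (w L) R step_initial L n" L]
      by (intro finite_measure_mono) (auto simp: grid_min simp del: grid.simps)
  qed
  show "b - c \<le> a"
  proof (rule LIMSEQ_le[OF tendsto_diff[OF lim_b lim_c] lim_a], intro exI allI impI)
    fix L
    let ?A = "{\<omega> \<in> space M. s < wall_grid (w L) (clock_rings n T L Nf \<omega>) v L n}"
    let ?C = "{\<omega> \<in> space M. free_grid (clock_rings n T L Nf \<omega>) v L n \<le> s}"
    have sets: "?A \<in> sets M" "?C \<in> sets M"
      using F_sets[of "\<lambda>L R. s < wall_grid (w L) R v L n" L] F_sets[of "\<lambda>L R. free_grid R v L n \<le> s" L]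
      by blast+
    \<comment> \<open>If the wall process from the step configuration exceeds \<open>s\<close>, then
      either the minimum does too or the free process is at most \<open>s\<close>.\<close>
    have "F (\<lambda>L R. s < wall_grid (w L) R step_initial L n) L \<le> prob (?A \<union> ?C)"
      unfolding F_def using sets
      by (intro finite_measure_mono) (auto simp: grid_min simp del: grid.simps)
    also have "\<dots> \<le> prob ?A + prob ?C" using sets by (rule measure_Un_le)
    finally show "F (\<lambda>L R. s < wall_grid (w L) R step_initial L n) L - F (\<lambda>L R. free_grid R v L n \<le> s) L
        \<le> F (\<lambda>L R. s < wall_grid (w L) R v L n) L"
      unfolding F_def by linarith
  qed
qed

text \<open>A sandwich of \<open>B S\<close> between \<open>A S\<close> and
  \<open>A (S + d)\<close>, closed by continuity of the limit as \<open>d\<close> tends to 0.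
  Openness of \<open>U\<close> leaves room for \<open>S + d\<close> and
  \<open>S - d\<close>.\<close>

lemma tendsto_shift_iff:
  fixes A B :: "real \<Rightarrow> 'a \<Rightarrow> real"
  assumes le: "\<And>S. \<forall>\<^sub>F T in net. A S T \<le> B S T"
    and shift: "\<And>S d. d > 0 \<Longrightarrow> \<forall>\<^sub>F T in net. B S T \<le> A (S + d) T"
    and U: "open U" and F: "continuous_on U F"
  shows "(\<forall>S\<in>U. (A S \<longlongrightarrow> F S) net) \<longleftrightarrow> (\<forall>S\<in>U. (B S \<longlongrightarrow> F S) net)"
proof -
  have near: "\<exists>d>0. S + d \<in> U \<and> S - d \<in> U \<and> F (S + d) < F S + e \<and> F S - e < F (S - d)"
    if S: "S \<in> U" and e: "e > 0" for S e
  proof -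
    obtain r where r: "r > 0" "ball S r \<subseteq> U" using U S by (rule openE)
    have "isCont F S" using F U S by (simp add: continuous_on_eq_continuous_at)
    then obtain r' where r': "r' > 0" "\<And>y. dist y S < r' \<Longrightarrow> dist (F y) (F S) < e"
      using e unfolding continuous_at_eps_delta dist_norm by blast
    define d where "d = min r r' / 2"
    have d: "0 < d" "d < r" "d < r'" using r r' by (auto simp: d_def)
    have "S + d \<in> ball S r" "S - d \<in> ball S r" using d by (auto simp: dist_real_def)
    then have "S + d \<in> U" "S - d \<in> U" using r by blast+
    moreover have "dist (F (S + d)) (F S) < e" "dist (F (S - d)) (F S) < e"
      by (rule r'(2), use d in \<open>simp add: dist_real_def\<close>)+
    ultimately show ?thesis using d(1) unfolding dist_real_def by (intro exI[of _ d]) auto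
  qed
  show ?thesis
  proof (intro iffI ballI)
    fix S assume A: "\<forall>S\<in>U. (A S \<longlongrightarrow> F S) net" and S: "S \<in> U"
    show "(B S \<longlongrightarrow> F S) net"
    proof (rule order_tendstoI)
      fix y assume "y < F S"
      then have "\<forall>\<^sub>F T in net. y < A S T" using A S by (auto dest: order_tendstoD)
      with le[of S] show "\<forall>\<^sub>F T in net. y < B S T" by eventually_elim simp
    next
      fix y assume "F S < y"
      then obtain d where d: "d > 0" "S + d \<in> U" "F (S + d) < y"
        using near[OF S, of "y - F S"] by auto
      then have "\<forall>\<^sub>F T in net. A (S + d) T < y" using A by (auto dest: order_tendstoD)
      with shift[OF d(1), of S] show "\<forall>\<^sub>F T in net. B S T < y" by eventually_elim simp
    qed
  next
    fix S assume B: "\<forall>S\<in>U. (B S \<longlongrightarrow> F S) net" and S: "S \<in> U"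
    show "(A S \<longlongrightarrow> F S) net"
    proof (rule order_tendstoI)
      fix y assume "F S < y"
      then have "\<forall>\<^sub>F T in net. B S T < y" using B S by (auto dest: order_tendstoD)
      with le[of S] show "\<forall>\<^sub>F T in net. A S T < y" by eventually_elim simp
    next
      fix y assume "y < F S"
      then obtain d where d: "d > 0" "S - d \<in> U" "y < F (S - d)"
        using near[OF S, of "F S - y"] by auto
      then have "\<forall>\<^sub>F T in net. y < B (S - d) T" using B by (auto dest: order_tendstoD)
      with shift[OF d(1), of "S - d"] show "\<forall>\<^sub>F T in net. y < A S T" by eventually_elim simp
    qed
  qed
qed

lemma prob_above_wall_eq:
  "prob_above_wall M Y h \<xi> S T =
    measure M {\<omega> \<in> space M. \<forall>t\<in>{0..T}. (\<xi> * T - S * T powr (1/3)) - h (T - t) < real_of_int (Y t \<omega>)}"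
  unfolding prob_above_wall_def by (simp add: algebra_simps)

theorem theorem2p3:
  fixes M :: "'w measure"
    and \<alpha> \<xi> g\<^sub>\<alpha> d\<^sub>0 C\<^sub>0 :: real
    and f :: "real \<Rightarrow> real \<Rightarrow> real"  \<comment> \<open>\<open>f T\<close> is the wall for observation time \<open>T\<close>\<close>
    and x0 :: "nat \<Rightarrow> int"
    and xf :: "real \<Rightarrow> nat \<Rightarrow> real \<Rightarrow> 'w \<Rightarrow> int"  \<comment> \<open>\<open>xf T\<close> is the process with wall \<open>f T\<close>\<close>
    and xt x :: "nat \<Rightarrow> real \<Rightarrow> 'w \<Rightarrow> int"
  assumes "prob_space M"
    and "0 < \<alpha>" "\<alpha> < 1"
    and "\<And>T. T > 0 \<Longrightarrow> wall (f T)"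
    and "strict_antimono_on {1..} x0" "x0 1 \<le> 0"
    and "d\<^sub>0 \<ge> 1" "\<And>n. n \<ge> 1 \<Longrightarrow> real_of_int (x0 n) \<ge> - d\<^sub>0 * real n - C\<^sub>0"
    and "\<And>T. T > 0 \<Longrightarrow> tasep_wall (f T) M x0 (xf T)"
    and "tasep M x0 xt"
    and "tasep M step_initial x"
    and "macroscopic_limit M (\<lambda>T \<omega>. real_of_int (xt (label (\<alpha> * T)) T \<omega>)) g\<^sub>\<alpha>"
    and "macroscopic_limit M (\<lambda>T \<omega>. real_of_int (xf T (label (\<alpha> * T)) T \<omega>)) \<xi>"
    and "\<xi> < g\<^sub>\<alpha>"
  defines "P \<equiv> \<lambda>S T. measure M {\<omega> \<in> space M.
             real_of_int (xf T (label (\<alpha> * T)) T \<omega>) > \<xi> * T - S * T powr (1/3)}"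
  shows
    \<comment> \<open>every \<open>S\<close>, wall at its lattice position \<open>\<lfloor>f\<rfloor>\<close> (the same as \<open>f\<close> if \<open>f\<close> is integer-valued)\<close>
    "(\<forall>S L. (P S \<longlongrightarrow> L) at_top \<longleftrightarrow>
        ((\<lambda>T. prob_above_wall M (x (label (\<alpha> * T))) (\<lambda>s. real_of_int \<lfloor>f T s\<rfloor>) \<xi> S T)
            \<longlongrightarrow> L) at_top) \<and>
    \<comment> \<open>real-valued \<open>f\<close> without rounding, wherever the limit is continuous in \<open>S\<close>\<close>
     (\<forall>U F. open U \<and> continuous_on U F \<longrightarrow>
        (\<forall>S\<in>U. (P S \<longlongrightarrow> F S) at_top) \<longleftrightarrow>
        (\<forall>S\<in>U. ((\<lambda>T. prob_above_wall M (x (label (\<alpha> * T))) (f T) \<xi> S T)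
            \<longlongrightarrow> F S) at_top))"
proof -
  interpret prob_space M by (rule assms(1))
  define n where "n T = label (\<alpha> * T)" for T
  define c where "c S T = \<xi> * T - S * T powr (1/3)" for S T
  define Q where "Q S T = prob_above_wall M (x (n T)) (\<lambda>s. real_of_int \<lfloor>f T s\<rfloor>) \<xi> S T" for S T
  define R where "R S T = prob_above_wall M (x (n T)) (f T) \<xi> S T" for S T
  define C where "C S T = prob {\<omega> \<in> space M. xt (n T) T \<omega> \<le> \<lfloor>c S T\<rfloor>}" for S T
  have x0: "ordered x0"
    using assms(5) unfolding ordered_def monotone_on_def by simp
  \<comment> \<open>Label \<open>0\<close> is no particle, so \<open>T\<close> must be at least
    \<open>1 / \<alpha>\<close>.\<close>
  have n_ge: "\<forall>\<^sub>F T in at_top. T > 0 \<and> n T \<ge> 1"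
    using eventually_ge_at_top[of "1 / \<alpha>"] eventually_gt_at_top[of 0]
  proof eventually_elim
    case (elim T)
    then have "1 \<le> \<alpha> * T" using assms(2) by (simp add: field_simps)
    then have "1 \<le> \<lfloor>\<alpha> * T\<rfloor>" by simp
    then show ?case using elim unfolding n_def label_def by linarith
  qed
  \<comment> \<open>Positions are integers, so the real threshold can be replaced by its floor, as
    \<open>wall_comparison\<close> requires.\<close>
  have P_eq: "P S T = prob {\<omega> \<in> space M. \<lfloor>c S T\<rfloor> < xf T (n T) T \<omega>}" for S T
    unfolding P_def c_def n_def by (simp add: floor_less_iff)
  have Q_eq: "Q S T = prob {\<omega> \<in> space M. \<forall>t\<in>{0..T}. \<lfloor>c S T\<rfloor> - \<lfloor>f T (T - t)\<rfloor> < x (n T) t \<omega>}" for S T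
  proof -
    have "c S T - real_of_int k < real_of_int y \<longleftrightarrow> \<lfloor>c S T\<rfloor> - k < y" for k y
      using floor_less_iff[of "c S T" "y + k"] by (auto simp: algebra_simps)
    then show ?thesis unfolding Q_def prob_above_wall_eq c_def by simp
  qed
  have comparison: "\<forall>\<^sub>F T in at_top. norm (P S T - Q S T) \<le> C S T" for S
    using n_ge
  proof eventually_elim
    case (elim T)
    then have T: "T > 0" and n: "n T \<ge> 1" by auto
    note wc = wall_comparison[OF assms(1) assms(4)[OF T] x0 assms(6) assms(9)[OF T] assms(10,11) T n,
        of "\<lfloor>c S T\<rfloor>"]
    have "P S T \<le> Q S T" "Q S T - C S T \<le> P S T"
      unfolding P_eq Q_eq C_def by (rule wc)+
    then show ?case by simp
  qed
  have C_0: "(C S \<longlongrightarrow> 0) at_top" for S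
  proof -
    \<comment> \<open>Half the macroscopic gap: the threshold divided by \<open>T\<close> tends to
      \<open>\<xi>\<close>, so it ends up below \<open>g\<^sub>\<alpha> - e\<close>, and the free
      process can be at or below it only by deviating by more than \<open>e\<close>.\<close>
    define e where "e = (g\<^sub>\<alpha> - \<xi>) / 2"
    have e: "e > 0" using assms(14) by (simp add: e_def)
    have "((\<lambda>T :: real. T powr (- 2/3)) \<longlongrightarrow> 0) at_top"
      by (rule tendsto_neg_powr) (auto intro: filterlim_ident)
    then have "((\<lambda>T. \<xi> - S * T powr (- 2/3)) \<longlongrightarrow> \<xi> - S * 0) at_top"
      by (intro tendsto_intros)
    then have "\<forall>\<^sub>F T in at_top. \<xi> - S * T powr (- 2/3) < g\<^sub>\<alpha> - e"
      by (rule order_tendstoD) (use assms(14) in \<open>simp add: e_def field_simps\<close>)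
    then have "\<forall>\<^sub>F T in at_top. norm (C S T) \<le>
        prob {\<omega> \<in> space M. \<bar>real_of_int (xt (n T) T \<omega>) / T - g\<^sub>\<alpha>\<bar> > e}"
      using n_ge
    proof eventually_elim
      case (elim T)
      then have T: "T > 0" and n: "n T \<ge> 1" by auto
      have [measurable]: "xt (n T) T \<in> measurable M (count_space UNIV)"
        using assms(10) T n unfolding tasep_def tasep_with_def by simp
      have "T powr (1/3) = T * T powr (- 2/3)"
        using T powr_add[of T 1 "- 2/3"] by simp
      then have c: "c S T / T = \<xi> - S * T powr (- 2/3)"
        using T by (simp add: c_def field_simps)
      have "\<bar>real_of_int (xt (n T) T \<omega>) / T - g\<^sub>\<alpha>\<bar> > e" if "xt (n T) T \<omega> \<le> \<lfloor>c S T\<rfloor>" for \<omega>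
      proof -
        have "real_of_int (xt (n T) T \<omega>) \<le> c S T" using that by (simp add: le_floor_iff)
        then have "real_of_int (xt (n T) T \<omega>) / T \<le> c S T / T"
          using T by (intro divide_right_mono) auto
        then show ?thesis using elim(1) c by linarith
      qed
      then have "C S T \<le> prob {\<omega> \<in> space M. \<bar>real_of_int (xt (n T) T \<omega>) / T - g\<^sub>\<alpha>\<bar> > e}"
        unfolding C_def by (intro finite_measure_mono) auto
      then show ?case by (simp add: C_def)
    qed
    moreover have "((\<lambda>T. prob {\<omega> \<in> space M. \<bar>real_of_int (xt (n T) T \<omega>) / T - g\<^sub>\<alpha>\<bar> > e}) \<longlongrightarrow> 0) at_top"
      using assms(12) e unfolding macroscopic_limit_def n_def by simp
    ultimately show ?thesis by (rule Lim_null_comparison)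
  qed
  have PQ: "((\<lambda>T. P S T - Q S T) \<longlongrightarrow> 0) at_top" for S
    by (rule Lim_null_comparison[OF comparison C_0])
  then have QP: "((\<lambda>T. Q S T - P S T) \<longlongrightarrow> 0) at_top" for S
    using tendsto_minus[OF PQ[of S]] by simp
  have PQ_iff: "(P S \<longlongrightarrow> L) at_top \<longleftrightarrow> (Q S \<longlongrightarrow> L) at_top" for S L
    using Lim_transform[OF _ PQ[of S], of L] Lim_transform[OF _ QP[of S], of L] by blast

  obtain Nx where Nx: "independent_poisson_clocks M Nx"
    and px: "\<And>\<omega>. \<omega> \<in> space M \<Longrightarrow>
      tasep_path (\<lambda>_ _. True) (\<lambda>n t. Nx n t \<omega>) step_initial (\<lambda>n t. x n t \<omega>)"
    using assms(11) unfolding tasep_def by (rule tasep_withE) (rule that)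
  have sets: "{\<omega> \<in> space M. \<forall>t\<in>{0..T}. a - f T (T - t) < real_of_int (x (n T) t \<omega>)} \<in> events"
    "{\<omega> \<in> space M. \<forall>t\<in>{0..T}. a - real_of_int \<lfloor>f T (T - t)\<rfloor> < real_of_int (x (n T) t \<omega>)} \<in> events"
    if T: "T > 0" and n: "n T \<ge> 1" for a T
  proof -
    have f: "mono_on {0..} (f T)" using assms(4)[OF T] unfolding wall_def by blast
    then have ff: "mono_on {0..} (\<lambda>t. real_of_int \<lfloor>f T t\<rfloor>)"
      unfolding mono_on_def by (simp add: floor_mono)
    show "{\<omega> \<in> space M. \<forall>t\<in>{0..T}. a - f T (T - t) < real_of_int (x (n T) t \<omega>)} \<in> events"
      by (rule above_wall_measurable_and_limit(1)[OF assms(1) Nx px f T n])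
    show "{\<omega> \<in> space M. \<forall>t\<in>{0..T}. a - real_of_int \<lfloor>f T (T - t)\<rfloor> < real_of_int (x (n T) t \<omega>)} \<in> events"
      by (rule above_wall_measurable_and_limit(1)[OF assms(1) Nx px ff T n])
  qed
  have QR: "\<forall>\<^sub>F T in at_top. Q S T \<le> R S T" for S
    using n_ge
  proof eventually_elim
    case (elim T)
    then have T: "T > 0" and n: "n T \<ge> 1" by auto
    have "a - f T (T - t) < y" if "a - real_of_int \<lfloor>f T (T - t)\<rfloor> < y" for a y t
      using that of_int_floor_le[of "f T (T - t)"] by linarith
    then show ?case
      unfolding Q_def R_def prob_above_wall_eq
      by (intro finite_measure_mono sets(1)[OF T n]) blast
  qed
  \<comment> \<open>From \<open>T = (1 / d) powr 3\<close> on, the shift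
    \<open>d * T powr (1/3)\<close> is at least 1 and absorbs the rounding of the wall.\<close>
  have RQ: "\<forall>\<^sub>F T in at_top. R S T \<le> Q (S + d) T" if d: "d > 0" for S d
    using n_ge eventually_ge_at_top[of "(1 / d) powr 3"]
  proof eventually_elim
    case (elim T)
    then have T: "T > 0" and n: "n T \<ge> 1" by auto
    have "((1 / d) powr 3) powr (1/3) \<le> T powr (1/3)"
      using elim d by (intro powr_mono2) auto
    then have "1 / d \<le> T powr (1/3)" using d unfolding powr_powr by simp
    then have "1 \<le> d * T powr (1/3)" using d by (simp add: field_simps)
    then have "(\<xi> * T - (S + d) * T powr (1/3)) - real_of_int \<lfloor>f T (T - t)\<rfloor> < y"
      if "(\<xi> * T - S * T powr (1/3)) - f T (T - t) < y" for y t
      using that floor_correct[of "f T (T - t)"] unfolding distrib_right by linarith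
    then show ?case
      unfolding Q_def R_def prob_above_wall_eq
      by (intro finite_measure_mono sets(2)[OF T n]) blast
  qed
  have "(\<forall>S\<in>U. (P S \<longlongrightarrow> F S) at_top) \<longleftrightarrow> (\<forall>S\<in>U. (R S \<longlongrightarrow> F S) at_top)"
    if "open U" "continuous_on U F" for U F
    unfolding PQ_iff by (rule tendsto_shift_iff[OF QR RQ that])
  then show ?thesis
    using PQ_iff unfolding Q_def[abs_def] R_def[abs_def] n_def by blast
qed

end
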